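(* Suppose that $G$ is a complete graph or an odd cycle with $|V(G)| \geq 3$. Suppose $H$ is a graph on at least two vertices that contains a Hamilton path $w_1, w_2, \ldots, w_m$ such that, for each $i$, $w_i$ has at most $k$ neighbors (in $H$) among $w_1, \ldots, w_{i-1}$. Then $AT(G \square H) \leq \Delta(G)+k$.
   Context: All graphs are finite and simple, and digraphs are simple. $\Delta(G)$ is the maximum degree of $G$. A Hamilton path $w_1,\ldots,w_m$ of $H$ is a listing of all vertices of $H$, each exactly once, with consecutive vertices adjacent in $H$. The Cartesian product $G \square H$ has vertex set $V(G)\times V(H)$, with $(u,v)$ adjacent to $(u',v')$ iff either $u=u'$ and $vv'\in E(H)$, or $v=v'$ and $uu'\in E(G)$. A circulation contained in a digraph $D$ is a spanning subdigraph $E$ of $D$ such that $d^-_E(v)=d^+_E(v)$ (indegree equals outdegree in $E$) for every $v\in V(D)$; it is even (resp. odd) if it has an even (resp. odd) number of edges (the edgeless circulation is even). The Alon-Tarsi number $AT(G)$ is the smallest $k$ for which there is an orientation $D$ of $G$ with maximum indegree $k-1$ such that the number of even circulations and the number of odd circulations contained in $D$ are different. *)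

theory Defs
  imports "Graph_Theory.Graph_Theory"
begin

text \<open>
  A finite simple graph is a finite, loop-free, symmetric digraph without parallel arcs
  (locale \<^locale>\<open>pair_graph\<close>): an undirected edge \<open>uv\<close> is represented by the two arcs
  \<open>(u, v)\<close> and \<open>(v, u)\<close>.  Orientations and their subdigraphs are values of the same record
  type, but with one arc per edge.
\<close>

text \<open>
  In the symmetric digraph representing a graph, the degree of a vertex is its out-degree.
  Both maxima below are meant for nonempty vertex sets only.
\<close>

definition max_degree :: "'a pair_pre_digraph \<Rightarrow> nat" where
  "max_degree G = Max (out_degree (with_proj G) ` pverts G)"

definition max_in_degree :: "'a pair_pre_digraph \<Rightarrow> nat" where
  "max_in_degree D = Max (in_degree (with_proj D) ` pverts D)"

definition complete_graph :: "'a pair_pre_digraph \<Rightarrow> bool" where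
  "complete_graph G \<longleftrightarrow> (\<exists>n. complete_digraph n (with_proj G))"

definition cycle_graph :: "nat \<Rightarrow> 'a pair_pre_digraph \<Rightarrow> bool" where
  "cycle_graph n G \<longleftrightarrow> n \<ge> 3 \<and> (\<exists>f. bij_betw f {..<n} (pverts G) \<and>
     parcs G = (\<Union>i<n. {(f i, f (Suc i mod n)), (f (Suc i mod n), f i)}))"

definition odd_cycle :: "'a pair_pre_digraph \<Rightarrow> bool" where
  "odd_cycle G \<longleftrightarrow> (\<exists>n. odd n \<and> cycle_graph n G)"

definition hamilton_path :: "'a pair_pre_digraph \<Rightarrow> 'a list \<Rightarrow> bool" where
  "hamilton_path H ws \<longleftrightarrow> vpath ws (with_proj H) \<and> set ws = pverts H"

definition cartesian_product ::
  "'a pair_pre_digraph \<Rightarrow> 'b pair_pre_digraph \<Rightarrow> ('a \<times> 'b) pair_pre_digraph"  (infixl \<open>\<box>\<close> 70) where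
  "G \<box> H = \<lparr> pverts = pverts G \<times> pverts H,
     parcs = {((u, v), (u', v')) | u v u' v'.
       u \<in> pverts G \<and> u' \<in> pverts G \<and> v \<in> pverts H \<and> v' \<in> pverts H \<and>
       (u = u' \<and> (v, v') \<in> parcs H \<or> v = v' \<and> (u, u') \<in> parcs G)} \<rparr>"

lemma pair_graph_cartesian_product:
  assumes "pair_graph G" "pair_graph H"
  shows "pair_graph (G \<box> H)"
proof -
  interpret G: pair_graph G by fact
  interpret H: pair_graph H by fact
  have fin: "finite (pverts (G \<box> H))"
    by (simp add: cartesian_product_def G.pair_finite_verts H.pair_finite_verts)
  have "parcs (G \<box> H) \<subseteq> pverts (G \<box> H) \<times> pverts (G \<box> H)"
    by (auto simp: cartesian_product_def)
  then have "finite (parcs (G \<box> H))"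
    by (rule finite_subset) (simp add: fin)
  moreover have "sym (parcs (G \<box> H))"
    using G.pair_sym_arcs H.pair_sym_arcs
    by (auto simp: cartesian_product_def symmetric_def sym_def)
  ultimately show ?thesis
    using fin by unfold_locales
      (auto simp: cartesian_product_def symmetric_def
        dest: G.pair_no_loops H.pair_no_loops)
qed

definition orientation :: "'a pair_pre_digraph \<Rightarrow> 'a pair_pre_digraph \<Rightarrow> bool" where
  "orientation D G \<longleftrightarrow> pverts D = pverts G \<and>
     parcs D \<union> (parcs D)\<inverse> = parcs G \<and> parcs D \<inter> (parcs D)\<inverse> = {}"

definition circulation :: "'a pair_pre_digraph \<Rightarrow> 'a pair_pre_digraph \<Rightarrow> bool" where
  "circulation E D \<longleftrightarrow> spanning (with_proj E) (with_proj D) \<and>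
     (\<forall>v \<in> pverts D. in_degree (with_proj E) v = out_degree (with_proj E) v)"

definition even_circulations :: "'a pair_pre_digraph \<Rightarrow> 'a pair_pre_digraph set" where
  "even_circulations D = {E. circulation E D \<and> even (card (parcs E))}"

definition odd_circulations :: "'a pair_pre_digraph \<Rightarrow> 'a pair_pre_digraph set" where
  "odd_circulations D = {E. circulation E D \<and> odd (card (parcs E))}"

text \<open>
  The minimum is attained for every graph with at least one vertex: the edgeless circulation
  is the only one in an acyclic orientation.  The maximum indegree is compared as
  \<open>max_in_degree D + 1 = k\<close> because \<open>k - 1\<close> is truncated at \<open>k = 0\<close> on the naturals.
\<close>

definition alon_tarsi_number :: "'a pair_pre_digraph \<Rightarrow> nat" where
  "alon_tarsi_number G = (LEAST k. \<exists>D. orientation D G \<and> max_in_degree D + 1 = k \<and>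
     card (even_circulations D) \<noteq> card (odd_circulations D))"

end

theory Submission
  imports Defs "HOL-Library.Poly_Mapping"
begin

text \<open>
  The graph polynomial \<open>\<Prod>(X u - X v)\<close> has, at the exponent given by the indegrees of an
  orientation, the coefficient \<open>\<plusminus>(even - odd)\<close> circulations of that orientation; so it suffices
  to find a nonzero coefficient of the polynomial of \<open>G \<box> H\<close> with all exponents below
  \<open>\<Delta>(G) + k\<close>.

  Both kinds of \<open>G\<close> are joins of an odd cycle \<open>C\<close> with a clique \<open>Q\<close> (\<open>Q = {}\<close> for an odd
  cycle, and \<open>C\<close> a triangle for a complete graph).  The layers \<open>G \<times> {w\<^sub>i}\<close> are added one at a
  time.  The clique vertices take the highest possible exponents, which loses nothing.
  On the cycle, when \<open>w\<^sub>i\<close> has exactly \<open>k\<close> earlier neighbours, the total exponent must be one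
  below the top, and the coefficient becomes a linear form in the earlier variables times
  the earlier polynomial.  Only linear forms \<open>\<Sum>j\<in>J. X (p, j) - X (q, j)\<close> with \<open>p, q \<in> C\<close> occur,
  and the invariant is that for every set \<open>J\<close> of layers containing the last one, some form
  of this kind does not annihilate the polynomial modulo high exponents.  It is preserved
  because on the cycle the new forms are the second differences of the old ones
  along the cycle, and a function on a cycle whose second differences vanish is constant.
\<close>

section \<open>Laurent polynomials with integer coefficients\<close>

text \<open>Integer exponents make the exponent vectors a group, so that multiplying by a monomial
  shifts coefficients without side conditions, as in \<open>lookup_lmonom_mult\<close>. Where
  negative exponents must be excluded, \<open>nonneg_expos\<close> does so.\<close>

type_synonym 'v laurent = "('v \<Rightarrow>\<^sub>0 int) \<Rightarrow>\<^sub>0 int"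

abbreviation lookup :: "('k \<Rightarrow>\<^sub>0 'c :: zero) \<Rightarrow> 'k \<Rightarrow> 'c" where
  "lookup \<equiv> Poly_Mapping.lookup"

abbreviation keys :: "('k \<Rightarrow>\<^sub>0 'c :: zero) \<Rightarrow> 'k set" where
  "keys \<equiv> Poly_Mapping.keys"

abbreviation expo :: "'v \<Rightarrow> 'v \<Rightarrow>\<^sub>0 int" where
  "expo v \<equiv> Poly_Mapping.single v 1"

definition lmonom :: "('v \<Rightarrow>\<^sub>0 int) \<Rightarrow> 'v laurent" where
  "lmonom e = Poly_Mapping.single e 1"

definition X :: "'v \<Rightarrow> 'v laurent" where
  "X v = lmonom (expo v)"

text \<open>On a set with one arc per edge this is the graph polynomial; reversing arcs changes at
  most the sign, see \<open>gpoly_flip\<close>.\<close>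

definition gpoly :: "('v \<times> 'v) set \<Rightarrow> 'v laurent" where
  "gpoly A = (\<Prod>(u, v)\<in>A. X u - X v)"

definition vfree :: "'v set \<Rightarrow> 'v laurent \<Rightarrow> bool" where
  "vfree W F \<longleftrightarrow> (\<forall>d\<in>keys F. \<forall>v\<in>W. lookup d v = 0)"

definition wdeg :: "'v set \<Rightarrow> ('v \<Rightarrow>\<^sub>0 int) \<Rightarrow> int" where
  "wdeg W d = (\<Sum>v\<in>W. lookup d v)"

definition homog :: "'v set \<Rightarrow> int \<Rightarrow> 'v laurent \<Rightarrow> bool" where
  "homog W h F \<longleftrightarrow> (\<forall>d\<in>keys F. wdeg W d = h)"

definition wdeg_le :: "'v set \<Rightarrow> int \<Rightarrow> 'v laurent \<Rightarrow> bool" where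
  "wdeg_le W h F \<longleftrightarrow> (\<forall>d\<in>keys F. wdeg W d \<le> h)"

definition nonneg_expos :: "'v laurent \<Rightarrow> bool" where
  "nonneg_expos F \<longleftrightarrow> (\<forall>d\<in>keys F. \<forall>v. 0 \<le> lookup d v)"

lemma lookup_expo: "lookup (expo u) v = (if u = v then 1 else 0)"
  by (simp add: lookup_single when_def)

lemma lmonom_mult: "lmonom a * lmonom b = lmonom (a + b)"
  by (simp add: lmonom_def mult_single)

lemma lmonom_0 [simp]: "lmonom 0 = 1"
  by (simp add: lmonom_def)

lemma keys_lmonom [simp]: "keys (lmonom e) = {e}"
  by (simp add: lmonom_def)

lemma lookup_lmonom_mult: "lookup (lmonom e * p) d = lookup p (d - e)"
proof -
  have "lookup (lmonom e * p) d = (\<Sum>q. lookup p q when d = e + q)"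
  proof -
    have eq: "lookup (lmonom e) l * (\<Sum>q. lookup p q when d = l + q)
        = ((\<Sum>q. lookup p q when d = l + q) when l = e)" for l
      by (simp add: lmonom_def lookup_single when_def)
    show ?thesis
      unfolding lookup_mult eq by simp
  qed
  also have "\<dots> = (\<Sum>q. lookup p q when q = d - e)"
    by (rule Sum_any.cong) (auto simp: when_def)
  finally show ?thesis by simp
qed

lemma lookup_X_mult: "lookup (X v * p) d = lookup p (d - expo v)"
  by (simp add: X_def lookup_lmonom_mult)

lemma laurent_expand: "(F :: 'v laurent) = (\<Sum>e\<in>keys F. of_int (lookup F e) * lmonom e)"
proof (rule poly_mapping_eqI)
  fix d
  have coeff_term: "lookup (of_int (lookup F e) * lmonom e) d = (if e = d then lookup F e else 0)" for e
    by (simp add: lmonom_def mult_single lookup_single when_def flip: single_of_int)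
  show "lookup F d = lookup (\<Sum>e\<in>keys F. of_int (lookup F e) * lmonom e) d"
    by (simp add: lookup_sum coeff_term in_keys_iff)
qed

lemma lookup_of_int_mult: "lookup (of_int c * F) d = c * lookup (F :: 'v laurent) d"
proof -
  have *: "of_int c * F = Poly_Mapping.map ((*) c) F"
    by (simp add: mult_map_scale_conv_mult flip: single_of_int)
  show ?thesis
    unfolding * by (simp add: map.rep_eq when_def)
qed

lemma lookup_mult_eq_sum:
  "lookup ((F :: 'v laurent) * H) d = (\<Sum>e\<in>keys F. lookup F e * lookup H (d - e))"
proof -
  have "lookup (F * H) d = lookup (\<Sum>e\<in>keys F. of_int (lookup F e) * (lmonom e * H)) d"
    by (subst (1) laurent_expand[of F]) (simp add: sum_distrib_right mult.assoc)
  then show ?thesis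
    by (simp add: lookup_sum lookup_of_int_mult lookup_lmonom_mult)
qed

lemma keys_mult_cases:
  assumes "d \<in> keys ((F :: 'v laurent) * H)"
  obtains a b where "a \<in> keys F" "b \<in> keys H" "d = a + b"
  using assms keys_mult[of F H] by blast

section \<open>Absent variables, partial degrees and homogeneity\<close>

lemma wdeg_add: "wdeg W (a + b) = wdeg W a + wdeg W b"
  by (simp add: wdeg_def lookup_add sum.distrib)

lemma wdeg_diff: "wdeg W (a - b) = wdeg W a - wdeg W b"
  by (simp add: wdeg_def lookup_minus sum_subtractf)

lemma wdeg_expo: "finite W \<Longrightarrow> wdeg W (expo v) = (if v \<in> W then 1 else 0)"
  by (simp add: wdeg_def lookup_expo)

lemma wdeg_sum: "wdeg W (sum f B) = (\<Sum>b\<in>B. wdeg W (f b))"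
  by (simp add: wdeg_def lookup_sum sum.swap[of _ W])

lemma vfree_0 [simp]: "vfree W 0" and vfree_1 [simp]: "vfree W 1"
  by (simp_all add: vfree_def)

lemma vfree_X: "v \<notin> W \<Longrightarrow> vfree W (X v)"
  by (auto simp: vfree_def X_def lookup_expo)

lemma vfree_mult: "vfree W F \<Longrightarrow> vfree W H \<Longrightarrow> vfree W (F * H)"
  by (auto simp: vfree_def lookup_add elim!: keys_mult_cases)

lemma vfree_add: "vfree W F \<Longrightarrow> vfree W H \<Longrightarrow> vfree W (F + H)"
  using keys_add[of F H] by (auto simp: vfree_def)

lemma vfree_diff: "vfree W F \<Longrightarrow> vfree W H \<Longrightarrow> vfree W (F - H)"
  using keys_diff[of F H] by (auto simp: vfree_def)

lemma vfree_sum: "(\<And>b. b \<in> B \<Longrightarrow> vfree W (f b)) \<Longrightarrow> vfree W (sum f B)"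
  by (induction B rule: infinite_finite_induct) (auto intro: vfree_add)

lemma vfree_prod: "(\<And>b. b \<in> B \<Longrightarrow> vfree W (f b)) \<Longrightarrow> vfree W (prod f B)"
  by (induction B rule: infinite_finite_induct) (auto intro: vfree_mult)

lemma vfree_gpoly: "A \<subseteq> (- W) \<times> (- W) \<Longrightarrow> vfree W (gpoly A)"
  unfolding gpoly_def by (auto intro!: vfree_prod vfree_diff vfree_X)

lemma vfree_mono: "vfree W F \<Longrightarrow> W' \<subseteq> W \<Longrightarrow> vfree W' F"
  by (auto simp: vfree_def)

lemma wdeg_le_0 [simp]: "wdeg_le W h 0"
  by (simp add: wdeg_le_def)

lemma wdeg_le_mult: "wdeg_le W a F \<Longrightarrow> wdeg_le W b H \<Longrightarrow> wdeg_le W (a + b) (F * H)"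
  by (fastforce simp: wdeg_le_def wdeg_add elim!: keys_mult_cases intro: add_mono)

lemma wdeg_le_add: "wdeg_le W h F \<Longrightarrow> wdeg_le W h H \<Longrightarrow> wdeg_le W h (F + H)"
  using keys_add[of F H] by (auto simp: wdeg_le_def)

lemma wdeg_le_diff: "wdeg_le W h F \<Longrightarrow> wdeg_le W h H \<Longrightarrow> wdeg_le W h (F - H)"
  using keys_diff[of F H] by (auto simp: wdeg_le_def)

lemma wdeg_le_uminus: "wdeg_le W h F \<Longrightarrow> wdeg_le W h (- F)"
  by (simp add: wdeg_le_def)

lemma wdeg_le_sum: "(\<And>b. b \<in> B \<Longrightarrow> wdeg_le W h (f b)) \<Longrightarrow> wdeg_le W h (sum f B)"
  by (induction B rule: infinite_finite_induct) (auto intro: wdeg_le_add)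

lemma wdeg_le_lmonom: "wdeg_le W (wdeg W e) (lmonom e)"
  by (simp add: wdeg_le_def)

lemma wdeg_le_vfree: "vfree W F \<Longrightarrow> wdeg_le W 0 F"
  by (simp add: wdeg_le_def vfree_def wdeg_def)

lemma wdeg_le_homog: "homog W h F \<Longrightarrow> wdeg_le W h F"
  by (simp add: wdeg_le_def homog_def)

lemma lookup_eq_0_if_wdeg_le: "wdeg_le W h F \<Longrightarrow> h < wdeg W d \<Longrightarrow> lookup F d = 0"
  by (force simp: wdeg_le_def in_keys_iff)

lemma homog_mult: "homog W a F \<Longrightarrow> homog W b H \<Longrightarrow> homog W (a + b) (F * H)"
  by (auto simp: homog_def wdeg_add elim!: keys_mult_cases)

lemma homog_diff: "homog W h F \<Longrightarrow> homog W h H \<Longrightarrow> homog W h (F - H)"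
  using keys_diff[of F H] by (auto simp: homog_def)

lemma homog_X: "finite W \<Longrightarrow> v \<in> W \<Longrightarrow> homog W 1 (X v)"
  by (simp add: homog_def X_def wdeg_expo)

lemma homog_gpoly:
  assumes "finite W" "A \<subseteq> W \<times> W"
  shows "homog W (int (card A)) (gpoly A)"
proof -
  have "finite A" using assms finite_subset by blast
  then show ?thesis
    using assms(2)
  proof (induction A rule: finite_induct)
    case empty
    show ?case by (simp add: gpoly_def homog_def wdeg_def)
  next
    case (insert a A)
    then have "homog W (1 + int (card A)) ((X (fst a) - X (snd a)) * gpoly A)"
      using assms(1) by (intro homog_mult homog_diff homog_X) auto
    then show ?case
      using insert.hyps by (simp add: gpoly_def case_prod_beta add.commute)
  qed
qed

lemma nonneg_expos_gpoly: "nonneg_expos (gpoly A)"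
proof (induction A rule: infinite_finite_induct)
  case (insert a A)
  have keys_X: "keys (X u - X v) \<subseteq> {expo u, expo v}" for u v :: 'a
    using keys_diff[of "X u" "X v"] by (auto simp: X_def)
  have "gpoly (insert a A) = (X (fst a) - X (snd a)) * gpoly A"
    using insert.hyps by (simp add: gpoly_def case_prod_beta)
  then show ?case
    using insert.IH keys_X
    by (fastforce simp: nonneg_expos_def lookup_add lookup_expo elim!: keys_mult_cases)
qed (simp_all add: gpoly_def nonneg_expos_def)

lemma lookup_eq_0_if_neg: "nonneg_expos F \<Longrightarrow> lookup d v < 0 \<Longrightarrow> lookup F d = 0"
  by (meson in_keys_iff linorder_not_le nonneg_expos_def)

text \<open>A monomial \<open>t\<close> of \<open>F\<close> finds a partner in \<open>H\<close> only
  if \<open>d + e - t\<close> vanishes on \<open>W\<close>. As \<open>t\<close> and \<open>e\<close>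
  vanish off \<open>W\<close>, this forces \<open>t = e\<close>, so a single pair
  contributes.\<close>

lemma lookup_mult_separate:
  assumes F: "vfree (- W) F" and H: "vfree W H"
    and e: "\<And>v. v \<notin> W \<Longrightarrow> lookup e v = 0" and d: "\<And>v. v \<in> W \<Longrightarrow> lookup d v = 0"
  shows "lookup (F * H) (d + e) = lookup F e * lookup H d"
proof -
  have "lookup H (d + e - t) = 0" if t: "t \<in> keys F" "t \<noteq> e" for t
  proof (rule ccontr)
    assume "lookup H (d + e - t) \<noteq> 0"
    then have "lookup (d + e - t) v = 0" if "v \<in> W" for v
      using H that by (auto simp: vfree_def in_keys_iff)
    then have "lookup t v = lookup e v" for v
      using F e d t by (cases "v \<in> W") (auto simp: lookup_add lookup_minus vfree_def)
    then show False
      using t by (auto intro: poly_mapping_eqI)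
  qed
  then have "lookup (F * H) (d + e) = (\<Sum>t\<in>keys F. if t = e then lookup F e * lookup H d else 0)"
    unfolding lookup_mult_eq_sum by (intro sum.cong) auto
  then show ?thesis
    by (simp add: in_keys_iff)
qed

section \<open>Adding a set of vertices\<close>

text \<open>The indegree vector of an arc set written as an exponent, see
  \<open>lookup_heads\<close>.\<close>

definition heads :: "('v \<times> 'v) set \<Rightarrow> 'v \<Rightarrow>\<^sub>0 int" where
  "heads B = (\<Sum>b\<in>B. expo (snd b))"

lemma wdeg_heads: "finite W \<Longrightarrow> B \<subseteq> UNIV \<times> W \<Longrightarrow> wdeg W (heads B) = int (card B)"
proof -
  assume "finite W" "B \<subseteq> UNIV \<times> W"
  then have "wdeg W (heads B) = (\<Sum>b\<in>B. 1)"
    unfolding heads_def wdeg_sum by (intro sum.cong) (auto simp: wdeg_expo)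
  then show ?thesis by simp
qed

lemma lookup_heads: "finite B \<Longrightarrow> lookup (heads B) v = int (card {y. (y, v) \<in> B})"
proof -
  assume fin: "finite B"
  have "lookup (heads B) v = (\<Sum>b\<in>B. if b \<in> (\<lambda>y. (y, v)) ` {y. (y, v) \<in> B} then 1 else 0)"
    unfolding heads_def lookup_sum lookup_expo by (rule sum.cong) auto
  also have "\<dots> = int (card (B \<inter> (\<lambda>y. (y, v)) ` {y. (y, v) \<in> B}))"
    using fin by (simp add: sum.If_cases Int_def)
  also have "B \<inter> (\<lambda>y. (y, v)) ` {y. (y, v) \<in> B} = (\<lambda>y. (y, v)) ` {y. (y, v) \<in> B}"
    by auto
  also have "card \<dots> = card {y. (y, v) \<in> B}"
    by (rule card_image) (auto simp: inj_on_def)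
  finally show ?thesis .
qed

lemma gpoly_insert: "finite A \<Longrightarrow> a \<notin> A \<Longrightarrow> gpoly (insert a A) = (X (fst a) - X (snd a)) * gpoly A"
  by (simp add: gpoly_def case_prod_beta)

lemma gpoly_empty [simp]: "gpoly {} = 1"
  by (simp add: gpoly_def)

lemma gpoly_Un: "finite A \<Longrightarrow> finite B \<Longrightarrow> A \<inter> B = {} \<Longrightarrow> gpoly (A \<union> B) = gpoly A * gpoly B"
  by (simp add: gpoly_def prod.union_disjoint)

text \<open>Sort the expansion by the number of factors from which the variable outside
  \<open>W\<close> is taken: none, one, or at least two. The last group loses at least two degrees
  in \<open>W\<close> and is collected in \<open>R\<close>.\<close>

lemma gpoly_cut_expand:
  assumes "finite W" "finite B" "B \<subseteq> (- W) \<times> W"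
  shows "\<exists>R. wdeg_le W (int (card B) - 2) R \<and>
    gpoly B = (-1) ^ card B *
      (lmonom (heads B) - (\<Sum>b\<in>B. X (fst b) * lmonom (heads B - expo (snd b)))) + R"
  using assms(2,3)
proof (induction B rule: finite_induct)
  case empty
  show ?case by (auto intro!: exI[of _ 0] simp: heads_def)
next
  case (insert a B)
  let ?y = "fst a" and ?x = "snd a" and ?s = "(-1) ^ card B :: 'a laurent"
  let ?M = "heads B" and ?M' = "heads (insert a B)"
  define S where "S = (\<Sum>b\<in>B. X (fst b) * lmonom (?M - expo (snd b)))"
  obtain R where R: "wdeg_le W (int (card B) - 2) R"
    and eq: "gpoly B = ?s * (lmonom ?M - S) + R"
    using insert unfolding S_def by auto
  \<comment> \<open>The new mixed term \<open>X ?y * S\<close> takes two outside variables, so it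
    moves into the remainder.\<close>
  define R' where "R' = (X ?y - X ?x) * R - ?s * (X ?y * S)"
  have y: "vfree W (X ?y)" and x: "?x \<in> W"
    using insert.prems by (auto intro: vfree_X)
  have M': "?M' = expo ?x + ?M"
    using insert.hyps by (simp add: heads_def)
  have X_le: "wdeg_le W 1 (X v)" for v
    using wdeg_le_lmonom[of W "expo v"] assms(1)
    by (simp add: X_def wdeg_expo wdeg_le_def)
  have wdS: "wdeg_le W (int (card B) - 1) S"
    unfolding S_def
  proof (rule wdeg_le_sum)
    fix b assume b: "b \<in> B"
    have "wdeg_le W (0 + wdeg W (?M - expo (snd b))) (X (fst b) * lmonom (?M - expo (snd b)))"
      using b insert.prems
      by (intro wdeg_le_mult wdeg_le_lmonom wdeg_le_vfree vfree_X) auto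
    moreover have "wdeg W (?M - expo (snd b)) = int (card B) - 1"
      using b insert.prems assms(1) by (subst wdeg_diff, subst wdeg_heads) (auto simp: wdeg_expo)
    ultimately show "wdeg_le W (int (card B) - 1) (X (fst b) * lmonom (?M - expo (snd b)))"
      by simp
  qed
  have "wdeg_le W (int (card B) - 1) R'"
    unfolding R'_def
  proof (rule wdeg_le_diff)
    show "wdeg_le W (int (card B) - 1) ((X ?y - X ?x) * R)"
      using wdeg_le_mult[OF wdeg_le_diff[OF X_le X_le] R] by (simp add: algebra_simps)
    have "wdeg_le W (int (card B) - 1) (X ?y * S)"
      using wdeg_le_mult[OF wdeg_le_vfree[OF y] wdS] by simp
    then show "wdeg_le W (int (card B) - 1) (?s * (X ?y * S))"
      by (cases "even (card B)") (auto intro: wdeg_le_uminus)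
  qed
  moreover have "(\<Sum>b\<in>insert a B. X (fst b) * lmonom (?M' - expo (snd b)))
      = X ?y * lmonom ?M + X ?x * S"
    using insert.hyps
    by (simp add: M' S_def sum_distrib_left X_def lmonom_mult algebra_simps)
  moreover have "lmonom ?M' = X ?x * lmonom ?M"
    by (simp add: M' X_def lmonom_mult)
  moreover have "gpoly (insert a B) = (X ?y - X ?x) * gpoly B"
    using insert.hyps by (simp add: gpoly_insert)
  ultimately show ?case
    using insert.hyps
    by (intro exI[of _ R']) (simp add: eq R'_def algebra_simps)
qed

text \<open>The remainder of \<open>gpoly_cut_expand\<close> has too small a degree on
  \<open>W\<close> to reach \<open>d + e\<close>, and the explicit terms separate into a factor on
  \<open>W\<close> and one off \<open>W\<close>. The sum over \<open>B\<close> is the source of the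
  linear forms in earlier variables.\<close>

lemma lookup_cut_subtop:
  assumes W: "finite W" and B: "finite B" "B \<subseteq> (- W) \<times> W"
    and c: "vfree (- W) c" "homog W h c" and F: "vfree W F"
    and e: "\<And>v. v \<notin> W \<Longrightarrow> lookup e v = 0" and d: "\<And>v. v \<in> W \<Longrightarrow> lookup d v = 0"
    and deg: "h + int (card B) - 1 \<le> wdeg W e"
  shows "lookup (c * F * gpoly B) (d + e) = (-1) ^ card B *
    (lookup c (e - heads B) * lookup F d
      - (\<Sum>b\<in>B. lookup c (e - heads B + expo (snd b)) * lookup (X (fst b) * F) d))"
proof -
  let ?M = "heads B"
  obtain R where R: "wdeg_le W (int (card B) - 2) R"
    and eq: "gpoly B = (-1) ^ card B * (lmonom ?M - (\<Sum>b\<in>B. X (fst b) * lmonom (?M - expo (snd b)))) + R"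
    using gpoly_cut_expand[OF W B] by blast
  have M: "lookup ?M v = 0" if "v \<notin> W" for v
  proof -
    have "{y. (y, v) \<in> B} = {}" using that B by auto
    then show ?thesis using B by (simp add: lookup_heads)
  qed
  have "c * F * gpoly B = of_int ((-1) ^ card B) * (lmonom ?M * (c * F)
      - (\<Sum>b\<in>B. lmonom (?M - expo (snd b)) * (c * (X (fst b) * F)))) + c * F * R"
    unfolding eq by (simp add: algebra_simps sum_distrib_left)
  moreover have "lookup (c * F * R) (d + e) = 0"
  proof (rule lookup_eq_0_if_wdeg_le)
    show "wdeg_le W (h + 0 + (int (card B) - 2)) (c * F * R)"
      by (rule wdeg_le_mult[OF wdeg_le_mult[OF wdeg_le_homog[OF c(2)] wdeg_le_vfree[OF F]] R])
    have "wdeg W d = 0"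
      using d by (simp add: wdeg_def)
    then show "h + 0 + (int (card B) - 2) < wdeg W (d + e)"
      using deg by (simp add: wdeg_add)
  qed
  moreover have "lookup (lmonom ?M * (c * F)) (d + e) = lookup c (e - ?M) * lookup F d"
    using lookup_mult_separate[OF c(1) F, of "e - ?M" d] e d M
    by (simp add: lookup_lmonom_mult lookup_minus add_diff_eq)
  moreover have "lookup (lmonom (?M - expo (snd b)) * (c * (X (fst b) * F))) (d + e)
      = lookup c (e - ?M + expo (snd b)) * lookup (X (fst b) * F) d" if b: "b \<in> B" for b
  proof -
    have "vfree W (X (fst b) * F)"
      using b B F by (auto intro!: vfree_mult vfree_X)
    moreover have "snd b \<in> W" using b B by auto
    ultimately have "lookup (c * (X (fst b) * F)) (d + (e - ?M + expo (snd b)))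
        = lookup c (e - ?M + expo (snd b)) * lookup (X (fst b) * F) d"
      using e d M by (intro lookup_mult_separate[OF c(1)]) (auto simp: lookup_minus lookup_add lookup_expo)
    moreover have "d + e - (?M - expo (snd b)) = d + (e - ?M + expo (snd b))"
      by (simp add: algebra_simps)
    ultimately show ?thesis
      by (simp only: lookup_lmonom_mult)
  qed
  ultimately show ?thesis
    by (simp add: lookup_add lookup_of_int_mult lookup_minus lookup_sum del: of_int_power)
qed

text \<open>At one degree more, homogeneity of \<open>c\<close> kills every term that takes an
  outside variable.\<close>

lemma lookup_cut_top:
  assumes W: "finite W" and B: "finite B" "B \<subseteq> (- W) \<times> W"
    and c: "vfree (- W) c" "homog W h c" and F: "vfree W F"
    and e: "\<And>v. v \<notin> W \<Longrightarrow> lookup e v = 0" and d: "\<And>v. v \<in> W \<Longrightarrow> lookup d v = 0"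
    and deg: "h + int (card B) \<le> wdeg W e"
  shows "lookup (c * F * gpoly B) (d + e) = (-1) ^ card B * (lookup c (e - heads B) * lookup F d)"
proof -
  have "lookup c (e - heads B + expo (snd b)) = 0" if "b \<in> B" for b
  proof (rule lookup_eq_0_if_wdeg_le[OF wdeg_le_homog[OF c(2)]])
    have "wdeg W (e - heads B + expo (snd b)) = wdeg W e - int (card B) + 1"
      using that B W by (subst wdeg_add, subst wdeg_diff, subst wdeg_heads) (auto simp: wdeg_expo)
    then show "h < wdeg W (e - heads B + expo (snd b))"
      using deg by simp
  qed
  then show ?thesis
    using deg by (subst lookup_cut_subtop[OF W B c F e d]) auto
qed

text \<open>Vertices enter the clique one by one, with all arcs at the new vertex pointing to it.
  Prescribing the full number of these arcs as its exponent forces its variable out of every factor,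
  so the coefficient changes only by a sign.\<close>

lemma lookup_cut_clique:
  fixes N :: "'v \<Rightarrow> 'v set"
  assumes "finite U" and "\<forall>u\<in>U. finite (N u) \<and> N u \<inter> U = {} \<and> card (N u) \<le> \<kappa>"
  shows "\<exists>A s c. A \<union> A\<inverse> = {(u, u'). u \<in> U \<and> u' \<in> U \<and> u \<noteq> u'} \<and> A \<inter> A\<inverse> = {} \<and> c \<noteq> 0 \<and>
    (\<forall>v. v \<notin> U \<longrightarrow> lookup s v = 0) \<and> (\<forall>v\<in>U. lookup s v < int (card U + \<kappa>)) \<and>
    (\<forall>F d. vfree U F \<longrightarrow> (\<forall>v\<in>U. lookup d v = 0) \<longrightarrow>
      lookup (F * gpoly (A \<union> {(y, u). u \<in> U \<and> y \<in> N u})) (d + s) = c * lookup F d)"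
  using assms
proof (induction U rule: finite_induct)
  case empty
  show ?case by (intro exI[of _ "{}"] exI[of _ 0] exI[of _ 1]) auto
next
  case (insert u U)
  let ?NU = "{(y, u). u \<in> U \<and> y \<in> N u}"
  have "\<forall>v\<in>U. finite (N v) \<and> N v \<inter> U = {} \<and> card (N v) \<le> \<kappa>"
    using insert.prems by blast
  from insert.IH[OF this] obtain A s c
    where IH: "A \<union> A\<inverse> = {(u, u'). u \<in> U \<and> u' \<in> U \<and> u \<noteq> u'} \<and> A \<inter> A\<inverse> = {} \<and> c \<noteq> 0 \<and>
      (\<forall>v. v \<notin> U \<longrightarrow> lookup s v = 0) \<and> (\<forall>v\<in>U. lookup s v < int (card U + \<kappa>)) \<and>
      (\<forall>F d. vfree U F \<longrightarrow> (\<forall>v\<in>U. lookup d v = 0) \<longrightarrow>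
        lookup (F * gpoly (A \<union> ?NU)) (d + s) = c * lookup F d)"
    by (elim exE) (rule that)
  note A = conjunct1[OF IH] conjunct1[OF conjunct2[OF IH]]
  note IH' = conjunct2[OF conjunct2[OF IH]]
  note c = conjunct1[OF IH']
  note s = conjunct1[OF conjunct2[OF IH'], rule_format]
    conjunct1[OF conjunct2[OF conjunct2[OF IH']], rule_format]
  note coeff = conjunct2[OF conjunct2[OF conjunct2[OF IH']], rule_format]
  have Nu: "finite (N u)" "N u \<inter> insert u U = {}" "card (N u) \<le> \<kappa>"
    and NU: "\<And>v. v \<in> U \<Longrightarrow> finite (N v) \<and> N v \<inter> insert u U = {}"
    using insert.prems by auto
  have AU: "A \<subseteq> U \<times> U" using A(1) by auto
  define B where "B = (N u \<union> U) \<times> {u}"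
  define s' where "s' = s + heads B"
  have B: "finite B" "B \<subseteq> (- {u}) \<times> {u}"
    using Nu insert.hyps by (auto simp: B_def)
  have card_B: "card B = card (N u) + card U"
    using Nu insert.hyps unfolding B_def by (subst card_cartesian_product, subst card_Un_disjoint) auto
  have heads_B: "lookup (heads B) v = (if v = u then int (card B) else 0)" for v
  proof -
    have "{y. (y, v) \<in> B} = (if v = u then N u \<union> U else {})"
      by (auto simp: B_def)
    then show ?thesis
      using B(1) by (simp add: lookup_heads) (simp add: B_def card_cartesian_product)
  qed
  have "?NU = (\<lambda>(u, y). (y, u)) ` (SIGMA u : U. N u)"
    by (auto simp: image_iff)
  then have fin: "finite (A \<union> ?NU)"
    using AU insert.hyps NU by (auto intro: finite_subset)
  have eq: "A \<union> U \<times> {u} \<union> {(y, v). v \<in> insert u U \<and> y \<in> N v} = (A \<union> ?NU) \<union> B"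
    by (auto simp: B_def)
  have disj: "(A \<union> ?NU) \<inter> B = {}"
    using AU insert.hyps by (auto simp: B_def)
  have r1: "lookup (F * gpoly (A \<union> U \<times> {u} \<union> {(y, v). v \<in> insert u U \<and> y \<in> N v})) (d + s')
      = (-1) ^ card B * c * lookup F d"
    if F: "vfree (insert u U) F" and d: "\<forall>v\<in>insert u U. lookup d v = 0" for F d
  proof -
    have "A \<union> ?NU \<subseteq> (- {u}) \<times> (- {u})"
      using AU NU insert.hyps by auto
    then have free: "vfree {u} (F * gpoly (A \<union> ?NU))"
      using F by (intro vfree_mult vfree_gpoly) (auto intro: vfree_mono)
    \<comment> \<open>Only the variable of \<open>u\<close> counts for the degree, and no further
      polynomial in it is present; hence the factor 1 of degree 0.\<close>
    have "lookup (1 * (F * gpoly (A \<union> ?NU)) * gpoly B) (d + s + heads B)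
      = (-1) ^ card B * (lookup 1 (heads B - heads B) * lookup (F * gpoly (A \<union> ?NU)) (d + s))"
    proof (rule lookup_cut_top[where W = "{u}" and h = 0])
      show "homog {u} 0 1" by (simp add: homog_def wdeg_def)
      show "lookup (d + s) v = 0" if "v \<in> {u}" for v
        using that d s(1) insert.hyps by (simp add: lookup_add)
      show "0 + int (card B) \<le> wdeg {u} (heads B)"
        by (simp add: wdeg_def heads_B)
    qed (use B free in \<open>auto simp: heads_B\<close>)
    moreover have "lookup (F * gpoly (A \<union> ?NU)) (d + s) = c * lookup F d"
      using F d by (intro coeff) (auto intro: vfree_mono)
    ultimately show ?thesis
      unfolding eq gpoly_Un[OF fin B(1) disj] s'_def by (simp add: add.assoc mult.assoc)
  qed
  have r2: "(A \<union> U \<times> {u}) \<union> (A \<union> U \<times> {u})\<inverse> = {(v, v'). v \<in> insert u U \<and> v' \<in> insert u U \<and> v \<noteq> v'}"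
    using A(1) insert.hyps by blast
  have r3: "(A \<union> U \<times> {u}) \<inter> (A \<union> U \<times> {u})\<inverse> = {}"
    using A(2) AU insert.hyps by blast
  have r4: "\<forall>v. v \<notin> insert u U \<longrightarrow> lookup s' v = 0"
    using s(1) by (simp add: s'_def lookup_add heads_B)
  have r5: "\<forall>v\<in>insert u U. lookup s' v < int (card (insert u U) + \<kappa>)"
    using s insert.hyps Nu(3) by (fastforce simp: s'_def lookup_add heads_B card_B)
  have r6: "(-1) ^ card B * c \<noteq> 0"
    using c by simp
  show ?case
    by (intro exI[of _ "A \<union> U \<times> {u}"] exI[of _ s'] exI[of _ "(-1) ^ card B * c"] conjI allI impI
        r1 r2 r3 r4 r5 r6)
qed

section \<open>Odd cycles\<close>

text \<open>On the vertex set of a cycle this is the indegree vector of either cyclic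
  orientation.\<close>

definition ones :: "'v set \<Rightarrow> 'v \<Rightarrow>\<^sub>0 int" where
  "ones W = (\<Sum>v\<in>W. expo v)"

lemma lookup_ones: "finite W \<Longrightarrow> lookup (ones W) v = (if v \<in> W then 1 else 0)"
  by (simp add: ones_def lookup_sum lookup_expo)

lemma wdeg_ones: "finite W \<Longrightarrow> wdeg W (ones W) = int (card W)"
  by (simp add: wdeg_def lookup_ones)

lemma lookup_vfree_eq_0: "vfree W F \<Longrightarrow> v \<in> W \<Longrightarrow> lookup d v \<noteq> 0 \<Longrightarrow> lookup F d = 0"
  by (auto simp: vfree_def in_keys_iff)

lemma lookup_homog_eq_0: "homog W h F \<Longrightarrow> wdeg W d \<noteq> h \<Longrightarrow> lookup F d = 0"
  by (auto simp: homog_def in_keys_iff)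

text \<open>Only the last factor contains the last variable, so the exponent there decides which
  variable that factor supplies. By induction one choice remains for every factor, and the sign
  counts the second variables taken.\<close>

lemma lookup_path:
  assumes "inj_on g {..m}"
  defines "P \<equiv> \<Prod>j<m. X (g j) - X (g (Suc j))"
  shows "lookup P (\<Sum>j<m. expo (g j)) = 1" and "lookup P (\<Sum>j<m. expo (g (Suc j))) = (-1) ^ m"
proof -
  have "lookup (\<Prod>j<m. X (g j) - X (g (Suc j))) (\<Sum>j<m. expo (g j)) = 1 \<and>
    lookup (\<Prod>j<m. X (g j) - X (g (Suc j))) (\<Sum>j<m. expo (g (Suc j))) = (-1) ^ m"
    using assms(1)
  proof (induction m)
    case 0
    then show ?case by (simp add: lookup_one)
  next
    case (Suc m)
    let ?P = "\<Prod>j<m. X (g j) - X (g (Suc j))"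
    have neq: "g j \<noteq> g (Suc m)" if "j \<le> m" for j
      using Suc.prems that by (fastforce simp: inj_on_def)
    have free: "vfree {g (Suc m)} ?P"
      using neq by (intro vfree_prod vfree_diff vfree_X) (auto simp: Suc_le_eq)
    have IH: "lookup ?P (\<Sum>j<m. expo (g j)) = 1" "lookup ?P (\<Sum>j<m. expo (g (Suc j))) = (-1) ^ m"
      using Suc.IH Suc.prems by (auto simp: inj_on_def)
    have step: "lookup (\<Prod>j<Suc m. X (g j) - X (g (Suc j))) d
        = lookup ?P (d - expo (g m)) - lookup ?P (d - expo (g (Suc m)))" for d
      by (simp add: mult.commute[of ?P] left_diff_distrib lookup_minus lookup_X_mult)
    \<comment> \<open>The wrong choice would require exponent -1 for a variable that
      \<open>?P\<close> does not contain.\<close>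
    have "lookup ?P ((\<Sum>j<Suc m. expo (g j)) - expo (g (Suc m))) = 0"
    proof (rule lookup_vfree_eq_0[OF free])
      have "lookup (\<Sum>j<Suc m. expo (g j)) (g (Suc m)) = 0"
        unfolding lookup_sum lookup_expo using neq by (intro sum.neutral) auto
      then show "lookup ((\<Sum>j<Suc m. expo (g j)) - expo (g (Suc m))) (g (Suc m)) \<noteq> 0"
        by (simp add: lookup_minus lookup_expo del: sum.lessThan_Suc)
    qed simp
    moreover have "lookup ?P ((\<Sum>j<Suc m. expo (g (Suc j))) - expo (g m)) = 0"
    proof (rule lookup_vfree_eq_0[OF free])
      have "lookup (\<Sum>j<m. expo (g (Suc j))) (g (Suc m)) = 0"
        unfolding lookup_sum lookup_expo using neq by (intro sum.neutral) (auto simp: Suc_le_eq)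
      then show "lookup ((\<Sum>j<Suc m. expo (g (Suc j))) - expo (g m)) (g (Suc m)) \<noteq> 0"
        using neq[of m] by (simp add: lookup_minus lookup_add lookup_expo)
    qed simp
    ultimately show ?case
      using IH by (simp add: step del: prod.lessThan_Suc)
  qed
  then show "lookup P (\<Sum>j<m. expo (g j)) = 1" and "lookup P (\<Sum>j<m. expo (g (Suc j))) = (-1) ^ m"
    by (simp_all add: P_def)
qed

locale cycle_core =
  fixes f :: "nat \<Rightarrow> 'v" and n :: nat and C :: "'v set"
  assumes bij: "bij_betw f {..<n} C" and n_ge_3: "3 \<le> n" and odd_n: "odd n"
begin

text \<open>Reading indices modulo \<open>n\<close> allows the cycle to be walked from any starting
  point.\<close>

definition vert :: "nat \<Rightarrow> 'v" where
  "vert i = f (i mod n)"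

definition cyc :: "('v \<times> 'v) set" where
  "cyc = (\<lambda>i. (vert i, vert (Suc i))) ` {..<n}"

lemma finite_C: "finite C"
  using bij bij_betw_finite by blast

lemma card_C: "card C = n"
  using bij_betw_same_card[OF bij] by simp

lemma vert_in_C [simp]: "vert i \<in> C"
  using bij n_ge_3 by (auto simp: vert_def bij_betw_def)

lemma vert_add_n: "vert (z + n) = vert z"
  by (simp add: vert_def)

lemma vert_eq_iff: "vert i = vert j \<longleftrightarrow> i mod n = j mod n"
  using bij n_ge_3 unfolding vert_def by (auto simp: bij_betw_def dest!: inj_onD)

lemma inj_on_vert_shift: "inj_on (\<lambda>j. vert (z + j)) {..<n}"
proof -
  have "i = j" if "i \<le> j" "j < n" "(z + i) mod n = (z + j) mod n" for i j
  proof -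
    have "n dvd (z + j) - (z + i)"
      using that by (subst mod_eq_dvd_iff_nat[symmetric]) auto
    then have "n dvd j - i" by simp
    then show ?thesis
      using that by (auto dest: dvd_imp_le simp: not_le)
  qed
  then show ?thesis
    unfolding inj_on_def vert_eq_iff by (metis lessThan_iff nle_le)
qed

lemma image_vert_shift: "(\<lambda>j. vert (z + j)) ` {..<n} = C"
  using inj_on_vert_shift[of z] finite_C
  by (intro card_subset_eq) (auto simp: card_image card_C)

lemma vert_cases:
  assumes "u \<in> C"
  obtains j where "j < n" "u = vert (z + j)"
  using assms image_vert_shift[of z] by auto

lemma vert_neq: "0 < j \<Longrightarrow> j < n \<Longrightarrow> vert (z + j) \<noteq> vert z"
  using inj_onD[OF inj_on_vert_shift[of z], of j 0] by auto

text \<open>Moving the starting point by one drops the arc of index 0 and gains the arc of index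
  \<open>n\<close>, which is the same arc.\<close>

lemma cyc_shift: "cyc = (\<lambda>j. (vert (z + j), vert (Suc (z + j)))) ` {..<n}"
proof (induction z)
  case 0
  show ?case by (simp add: cyc_def)
next
  case (Suc z)
  let ?a = "\<lambda>j. (vert (z + j), vert (Suc (z + j)))"
  obtain m where m: "n = Suc m" using n_ge_3 by (cases n) auto
  have "?a n = ?a 0"
    using vert_add_n[of z] vert_add_n[of "Suc z"] by simp
  then have "?a ` {..<n} = (\<lambda>j. ?a (Suc j)) ` {..<n}"
    unfolding m by (subst lessThan_Suc, subst lessThan_Suc_eq_insert_0) (auto simp: image_iff)
  then show ?case using Suc by simp
qed

lemma cyc_subset: "cyc \<subseteq> C \<times> C"
  by (auto simp: cyc_def)

lemma finite_cyc: "finite cyc"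
  by (simp add: cyc_def)

lemma card_cyc: "card cyc = n"
proof -
  have "inj_on (\<lambda>i. (vert i, vert (Suc i))) {..<n}"
    using inj_on_vert_shift[of 0] by (auto simp: inj_on_def)
  then show ?thesis by (simp add: cyc_def card_image)
qed

text \<open>The factors of all cycle edges except the one from \<open>vert z\<close> to
  \<open>vert (Suc z)\<close>, walked from \<open>vert (Suc z)\<close> round to
  \<open>vert z\<close>.\<close>

definition path :: "nat \<Rightarrow> 'v laurent" where
  "path z = (\<Prod>j<n - 1. X (vert (Suc z + j)) - X (vert (Suc z + Suc j)))"

lemma gpoly_cyc: "gpoly cyc = (X (vert z) - X (vert (Suc z))) * path z"
proof -
  have "inj_on (\<lambda>j. (vert (z + j), vert (Suc (z + j)))) {..<n}"
    using inj_on_vert_shift[of z] by (auto simp: inj_on_def)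
  then have "gpoly cyc = (\<Prod>j<n. X (vert (z + j)) - X (vert (Suc (z + j))))"
    unfolding gpoly_def cyc_shift[of z] by (subst prod.reindex) auto
  then show ?thesis
    using prod.lessThan_Suc_shift[of "\<lambda>j. X (vert (z + j)) - X (vert (Suc (z + j)))" "n - 1"] n_ge_3
    by (simp add: path_def)
qed

text \<open>The path has \<open>n - 1\<close> edges, an even number, so the sign from
  \<open>lookup_path\<close> is +1 at both ends. This is where the oddness of \<open>n\<close>
  enters.\<close>

lemma lookup_path_tails: "lookup (path z) (ones C - expo (vert z)) = 1"
  and lookup_path_heads: "lookup (path z) (ones C - expo (vert (Suc z))) = 1"
proof -
  let ?g = "\<lambda>j. vert (Suc z + j)"
  have n: "Suc (n - 1) = n" using n_ge_3 by simp
  have inj: "inj_on ?g {..n - 1}"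
    using inj_on_vert_shift[of "Suc z"] by (simp only: lessThan_Suc_atMost[symmetric] n)
  have tails: "ones C = (\<Sum>j<Suc (n - 1). expo (?g j))"
    unfolding ones_def n image_vert_shift[of "Suc z", symmetric]
    using inj_on_vert_shift[of "Suc z"] by (subst sum.reindex) auto
  then have heads: "ones C = expo (?g 0) + (\<Sum>j<n - 1. expo (?g (Suc j)))"
    by (simp only: sum.lessThan_Suc_shift)
  have "?g (n - 1) = vert z"
    using vert_add_n[of z] n by simp
  then have "ones C - expo (vert z) = (\<Sum>j<n - 1. expo (?g j))"
    using tails by simp
  moreover have "ones C - expo (vert (Suc z)) = (\<Sum>j<n - 1. expo (?g (Suc j)))"
    using heads by simp
  ultimately show "lookup (path z) (ones C - expo (vert z)) = 1"
    and "lookup (path z) (ones C - expo (vert (Suc z))) = 1"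
    using lookup_path[OF inj] odd_n by (simp_all add: path_def)
qed

lemma nonneg_expos_path: "nonneg_expos (path z)"
proof -
  let ?g = "\<lambda>j. (vert (Suc z + j), vert (Suc z + Suc j))"
  have "inj_on ?g {..<n - 1}"
    using inj_on_vert_shift[of "Suc z"] by (auto simp: inj_on_def)
  then have "path z = gpoly (?g ` {..<n - 1})"
    by (simp add: path_def gpoly_def prod.reindex)
  then show ?thesis by (simp add: nonneg_expos_gpoly)
qed

text \<open>The two cyclic orientations of an odd cycle contribute with opposite signs.\<close>

lemma lookup_gpoly_cyc_ones: "lookup (gpoly cyc) (ones C) = 0"
  by (simp add: gpoly_cyc[of 0] left_diff_distrib lookup_minus lookup_X_mult
      lookup_path_tails lookup_path_heads)

text \<open>Multiplying the cycle polynomial by \<open>X v + X v'\<close> for an edge \<open>vv'\<close> turns the factor of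
  that edge into a difference of squares; the coefficients of the remaining path are read off.\<close>

lemma lookup_edge_sum_gpoly_cyc:
  "lookup ((X (vert z) + X (vert (Suc z))) * gpoly cyc) (ones C + expo u)
    = of_bool (u = vert z) - of_bool (u = vert (Suc z))"
proof -
  let ?a = "vert z" and ?b = "vert (Suc z)"
  have ab: "?a \<noteq> ?b"
    using vert_neq[of 1 z] n_ge_3 by simp
  have "(X ?a + X ?b) * gpoly cyc = X ?a * (X ?a * path z) - X ?b * (X ?b * path z)"
    by (simp add: gpoly_cyc[of z] algebra_simps)
  then have "lookup ((X ?a + X ?b) * gpoly cyc) (ones C + expo u)
    = lookup (path z) (ones C + expo u - expo ?a - expo ?a)
      - lookup (path z) (ones C + expo u - expo ?b - expo ?b)"
    by (simp add: lookup_minus lookup_X_mult)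
  \<comment> \<open>For \<open>u\<close> different from \<open>?a\<close> the exponent at
    \<open>?a\<close> is 1 - 2 = -1, which \<open>path z\<close> cannot have.\<close>
  moreover have "lookup (path z) (ones C + expo u - expo ?a - expo ?a) = of_bool (u = ?a)"
    using lookup_path_tails[of z] lookup_eq_0_if_neg[OF nonneg_expos_path, of "ones C + expo u - expo ?a - expo ?a" ?a]
    by (cases "u = ?a") (auto simp: lookup_minus lookup_add lookup_expo lookup_ones finite_C)
  moreover have "lookup (path z) (ones C + expo u - expo ?b - expo ?b) = of_bool (u = ?b)"
    using lookup_path_heads[of z] lookup_eq_0_if_neg[OF nonneg_expos_path, of "ones C + expo u - expo ?b - expo ?b" ?b]
    by (cases "u = ?b") (auto simp: lookup_minus lookup_add lookup_expo lookup_ones finite_C)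
  ultimately show ?thesis by simp
qed

text \<open>The chord form is the difference of two consecutive edge sums, so its coefficients are a
  difference of first differences.\<close>

lemma lookup_chord_gpoly_cyc:
  "lookup ((X (vert z) - X (vert (z + 2))) * gpoly cyc) (ones C + expo u)
    = of_bool (u = vert z) - 2 * of_bool (u = vert (Suc z)) + of_bool (u = vert (z + 2))"
proof -
  have "(X (vert z) - X (vert (z + 2))) * gpoly cyc
    = (X (vert z) + X (vert (Suc z))) * gpoly cyc
      - (X (vert (Suc z)) + X (vert (Suc (Suc z)))) * gpoly cyc"
    by (simp add: algebra_simps)
  then show ?thesis
    by (simp only: lookup_minus lookup_edge_sum_gpoly_cyc) simp
qed

text \<open>The first difference is a constant \<open>\<delta>\<close>; once round the cycle the
  value has changed by \<open>n * \<delta>\<close>, which must be 0.\<close>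

lemma second_difference_eq_0_imp_const:
  fixes y :: "'v \<Rightarrow> int"
  assumes "\<And>z. y (vert z) - 2 * y (vert (Suc z)) + y (vert (z + 2)) = 0" and "p \<in> C" "q \<in> C"
  shows "y p = y q"
proof -
  define \<delta> where "\<delta> = y (vert 1) - y (vert 0)"
  have step: "y (vert (Suc i)) - y (vert i) = \<delta>" for i
  proof (induction i)
    case (Suc i)
    then show ?case using assms(1)[of i] by simp
  qed (simp add: \<delta>_def)
  have lin: "y (vert i) = y (vert 0) + int i * \<delta>" for i
  proof (induction i)
    case (Suc i)
    then show ?case using step[of i] by (simp add: algebra_simps)
  qed simp
  have "vert n = vert 0" by (simp add: vert_def)
  then have "\<delta> = 0"
    using lin[of n] n_ge_3 by simp
  then have "y (vert i) = y (vert 0)" for i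
    using lin[of i] by simp
  then show ?thesis
    using assms(2,3) by (metis vert_cases)
qed

end

section \<open>Attaching an odd cycle to earlier vertices\<close>

context cycle_core
begin

text \<open>\<open>Z\<close> holds the summands of a linear form that lie outside the new cycle.
  With exponent \<open>\<kappa> + 2\<close> available, a coefficient of top degree on
  \<open>C\<close> reduces to one of \<open>F\<close>. With \<open>\<kappa> + 1\<close> at every
  vertex of \<open>C\<close>, one degree below the top, the coefficient is up to sign a second
  difference along the cycle of the coefficients given by the neighbour sums, and some second
  difference is nonzero unless these all agree.\<close>

lemma cycle_extension:
  fixes N :: "'v \<Rightarrow> 'v set" and Z :: "'v \<Rightarrow> 'v laurent"
  defines "P \<equiv> gpoly (cyc \<union> {(y, u). u \<in> C \<and> y \<in> N u})"
  assumes F: "vfree C F" and N: "\<And>u. u \<in> C \<Longrightarrow> finite (N u) \<and> N u \<inter> C = {} \<and> card (N u) = \<kappa>"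
    and Z: "\<And>u. u \<in> C \<Longrightarrow> vfree C (Z u)" and d: "\<forall>v\<in>C. lookup d v = 0"
  shows
    cycle_extension_top: "lookup F d \<noteq> 0 \<Longrightarrow> \<exists>p\<in>C. \<exists>q\<in>C. \<exists>e. (\<forall>v. v \<notin> C \<longrightarrow> lookup e v = 0) \<and>
      (\<forall>v. lookup e v \<le> int \<kappa> + 2) \<and> lookup ((X p + Z p - (X q + Z q)) * (F * P)) (d + e) \<noteq> 0"
    and cycle_extension_subtop:
      "\<lbrakk>p' \<in> C; q' \<in> C; lookup (((\<Sum>y\<in>N p'. X y) - (\<Sum>y\<in>N q'. X y)) * F) d \<noteq> 0\<rbrakk> \<Longrightarrow>
      \<exists>p\<in>C. \<exists>q\<in>C. \<exists>e. (\<forall>v. v \<notin> C \<longrightarrow> lookup e v = 0) \<and>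
      (\<forall>v. lookup e v \<le> int \<kappa> + 1) \<and> lookup ((X p + Z p - (X q + Z q)) * (F * P)) (d + e) \<noteq> 0"
proof -
  define B where "B = {(y, u). u \<in> C \<and> y \<in> N u}"
  have B_image: "B = (\<lambda>(u, y). (y, u)) ` (SIGMA u : C. N u)"
    by (auto simp: B_def image_iff)
  have finB: "finite B"
    unfolding B_image using finite_C N by auto
  have Bsub: "B \<subseteq> (- C) \<times> C"
    using N by (auto simp: B_def)
  have inj: "inj_on (\<lambda>(u, y). (y, u)) (SIGMA u : C. N u)"
    by (auto simp: inj_on_def)
  have heads_B: "lookup (heads B) v = (if v \<in> C then int \<kappa> else 0)" for v
  proof -
    have "{y. (y, v) \<in> B} = (if v \<in> C then N v else {})"
      by (auto simp: B_def)
    then show ?thesis using finB N by (simp add: lookup_heads)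
  qed
  have wdeg_B: "wdeg C (heads B) = int (card B)"
    using finite_C Bsub by (intro wdeg_heads) auto
  have P: "P = gpoly cyc * gpoly B"
    unfolding P_def B_def[symmetric] using cyc_subset Bsub
    by (intro gpoly_Un finite_cyc finB) auto
  have cyc_free: "vfree (- C) (gpoly cyc)"
    using cyc_subset by (intro vfree_gpoly) auto
  have cyc_homog: "homog C (int n) (gpoly cyc)"
    using homog_gpoly[OF finite_C cyc_subset] by (simp add: card_cyc)
  have c_free: "vfree (- C) ((X p - X q) * gpoly cyc)" if "p \<in> C" "q \<in> C" for p q
    using that cyc_free by (intro vfree_mult vfree_diff vfree_X) auto
  have c_homog: "homog C (1 + int n) ((X p - X q) * gpoly cyc)" if "p \<in> C" "q \<in> C" for p q
    using that cyc_homog finite_C by (intro homog_mult homog_diff homog_X) auto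
  \<comment> \<open>In the \<open>Z\<close> part the only factor on \<open>C\<close> besides the cut
    is \<open>gpoly cyc\<close> of degree \<open>n\<close>, so \<open>lookup_cut_top\<close> applies
    to it from degree \<open>n\<close> on.\<close>
  have split: "lookup ((X p + Z p - (X q + Z q)) * (F * P)) (d + (heads B + e))
    = lookup ((X p - X q) * gpoly cyc * F * gpoly B) (d + (heads B + e))
      + (-1) ^ card B * (lookup (gpoly cyc) e * lookup ((Z p - Z q) * F) d)"
    if pq: "p \<in> C" "q \<in> C" and e: "\<And>v. v \<notin> C \<Longrightarrow> lookup e v = 0" "int n \<le> wdeg C e" for p q e
  proof -
    have "(X p + Z p - (X q + Z q)) * (F * P)
      = (X p - X q) * gpoly cyc * F * gpoly B + gpoly cyc * ((Z p - Z q) * F) * gpoly B"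
      by (simp add: P algebra_simps)
    moreover have "lookup (gpoly cyc * ((Z p - Z q) * F) * gpoly B) (d + (heads B + e))
      = (-1) ^ card B * (lookup (gpoly cyc) (heads B + e - heads B) * lookup ((Z p - Z q) * F) d)"
      using pq e d F Z
      by (intro lookup_cut_top[OF finite_C finB Bsub cyc_free cyc_homog] vfree_mult vfree_diff)
        (auto simp: lookup_add heads_B wdeg_add wdeg_B)
    ultimately show ?thesis by (simp add: lookup_add)
  qed
  {
    assume Fd: "lookup F d \<noteq> 0"
    \<comment> \<open>The surplus exponent is placed at \<open>vert 0\<close>, where this chord has
      coefficient 1.\<close>
    let ?p = "vert 0" and ?q = "vert 2"
    define e where "e = ones C + expo (vert 0)"
    have wdeg_e: "wdeg C e = int n + 1"
      by (simp add: e_def wdeg_add wdeg_ones wdeg_expo finite_C card_C)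
    have e0: "lookup e v = 0" if "v \<notin> C" for v
      using that vert_in_C[of 0] by (auto simp: e_def lookup_add lookup_ones lookup_expo finite_C)
    \<comment> \<open>Degree \<open>n + 1\<close> is too large for \<open>gpoly cyc\<close>, so the
      \<open>Z\<close> part vanishes.\<close>
    have "lookup (gpoly cyc) e = 0"
      using wdeg_e by (intro lookup_homog_eq_0[OF cyc_homog]) auto
    moreover have "lookup ((X ?p - X ?q) * gpoly cyc * F * gpoly B) (d + (heads B + e))
      = (-1) ^ card B * (lookup ((X ?p - X ?q) * gpoly cyc) (heads B + e - heads B) * lookup F d)"
      using e0 d F
      by (intro lookup_cut_top[OF finite_C finB Bsub c_free c_homog])
        (auto simp: lookup_add heads_B wdeg_add wdeg_B wdeg_e)
    moreover have "lookup ((X ?p - X ?q) * gpoly cyc) e = 1"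
      using lookup_chord_gpoly_cyc[of 0 "vert 0"] vert_neq[of 1 0] vert_neq[of 2 0] n_ge_3
      by (simp add: e_def numeral_2_eq_2)
    ultimately have nz: "lookup ((X ?p + Z ?p - (X ?q + Z ?q)) * (F * P)) (d + (heads B + e)) \<noteq> 0"
      using Fd e0 wdeg_e by (simp add: split)
    have off: "lookup (heads B + e) v = 0" if "v \<notin> C" for v
      using that e0 by (simp add: lookup_add heads_B)
    have le: "lookup (heads B + e) v \<le> int \<kappa> + 2" for v
      by (simp add: e_def lookup_add heads_B lookup_ones lookup_expo finite_C)
    show "\<exists>p\<in>C. \<exists>q\<in>C. \<exists>e. (\<forall>v. v \<notin> C \<longrightarrow> lookup e v = 0) \<and>
      (\<forall>v. lookup e v \<le> int \<kappa> + 2) \<and> lookup ((X p + Z p - (X q + Z q)) * (F * P)) (d + e) \<noteq> 0"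
      by (intro bexI[of _ ?p] bexI[of _ ?q] exI[of _ "heads B + e"] conjI allI impI nz off le vert_in_C)
  next
    assume pq': "p' \<in> C" "q' \<in> C" and ne: "lookup (((\<Sum>y\<in>N p'. X y) - (\<Sum>y\<in>N q'. X y)) * F) d \<noteq> 0"
    define y where "y u = lookup ((\<Sum>w\<in>N u. X w) * F) d" for u
    have "y p' \<noteq> y q'"
      using ne by (simp add: y_def left_diff_distrib lookup_minus)
    then obtain z where z: "y (vert z) - 2 * y (vert (Suc z)) + y (vert (z + 2)) \<noteq> 0"
      using second_difference_eq_0_imp_const[of y] pq' by metis
    let ?p = "vert z" and ?q = "vert (z + 2)"
    let ?c = "(X ?p - X ?q) * gpoly cyc"
    have wdeg_1: "wdeg C (ones C) = int n"
      by (simp add: wdeg_ones finite_C card_C)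
    \<comment> \<open>As \<open>?c\<close> has degree \<open>n + 1\<close>, only terms taking one
      earlier variable survive.\<close>
    have "lookup ?c (ones C) = 0"
      using wdeg_1 by (intro lookup_homog_eq_0[OF c_homog]) auto
    moreover have "lookup (?c * F * gpoly B) (d + (heads B + ones C))
      = (-1) ^ card B * (lookup ?c (heads B + ones C - heads B) * lookup F d
        - (\<Sum>b\<in>B. lookup ?c (heads B + ones C - heads B + expo (snd b)) * lookup (X (fst b) * F) d))"
      using d F
      by (intro lookup_cut_subtop[OF finite_C finB Bsub c_free c_homog])
        (auto simp: lookup_add heads_B wdeg_add wdeg_B wdeg_1 lookup_ones finite_C)
    moreover have "(\<Sum>b\<in>B. lookup ?c (ones C + expo (snd b)) * lookup (X (fst b) * F) d)
      = (\<Sum>u\<in>C. lookup ?c (ones C + expo u) * y u)"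
    proof -
      have "(\<Sum>b\<in>B. lookup ?c (ones C + expo (snd b)) * lookup (X (fst b) * F) d)
        = (\<Sum>(u, w)\<in>(SIGMA u : C. N u). lookup ?c (ones C + expo u) * lookup (X w * F) d)"
        unfolding B_image by (subst sum.reindex[OF inj]) (simp add: case_prod_beta)
      also have "\<dots> = (\<Sum>u\<in>C. \<Sum>w\<in>N u. lookup ?c (ones C + expo u) * lookup (X w * F) d)"
        using finite_C N by (subst sum.Sigma) auto
      also have "\<dots> = (\<Sum>u\<in>C. lookup ?c (ones C + expo u) * y u)"
        by (simp add: y_def sum_distrib_left sum_distrib_right lookup_sum)
      finally show ?thesis .
    qed
    moreover have "(\<Sum>u\<in>C. lookup ?c (ones C + expo u) * y u)
      = y (vert z) - 2 * y (vert (Suc z)) + y (vert (z + 2))"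
    proof -
      have delta: "(\<Sum>u\<in>C. of_bool (u = vert i) * y u) = y (vert i)" for i
        using finite_C by (simp add: of_bool_def if_distrib[of "\<lambda>b. b * _"] cong: if_cong)
      have "lookup ?c (ones C + expo u) * y u = of_bool (u = vert z) * y u
          - 2 * (of_bool (u = vert (Suc z)) * y u) + of_bool (u = vert (z + 2)) * y u" for u
        unfolding lookup_chord_gpoly_cyc by (simp only: algebra_simps)
      then show ?thesis
        by (simp only: sum.distrib sum_subtractf delta flip: sum_distrib_left)
    qed
    \<comment> \<open>The \<open>Z\<close> part drops out because \<open>gpoly cyc\<close> has
      coefficient zero at \<open>ones C\<close>.\<close>
    ultimately have nz: "lookup ((X ?p + Z ?p - (X ?q + Z ?q)) * (F * P)) (d + (heads B + ones C)) \<noteq> 0"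
      using z by (simp add: split lookup_ones finite_C wdeg_1 lookup_gpoly_cyc_ones)
    have off: "lookup (heads B + ones C) v = 0" if "v \<notin> C" for v
      using that by (simp add: lookup_add heads_B lookup_ones finite_C)
    have le: "lookup (heads B + ones C) v \<le> int \<kappa> + 1" for v
      by (simp add: lookup_add heads_B lookup_ones finite_C)
    show "\<exists>p\<in>C. \<exists>q\<in>C. \<exists>e. (\<forall>v. v \<notin> C \<longrightarrow> lookup e v = 0) \<and>
      (\<forall>v. lookup e v \<le> int \<kappa> + 1) \<and> lookup ((X p + Z p - (X q + Z q)) * (F * P)) (d + e) \<noteq> 0"
      by (intro bexI[of _ ?p] bexI[of _ ?q] exI[of _ "heads B + ones C"] conjI allI impI nz off le vert_in_C)
  }
qed

end

section \<open>Coefficients of the graph polynomial and circulations\<close>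

text \<open>The outdegree vector, that is, \<open>heads\<close> of the converse.\<close>

definition tails :: "('v \<times> 'v) set \<Rightarrow> 'v \<Rightarrow>\<^sub>0 int" where
  "tails B = (\<Sum>b\<in>B. expo (fst b))"

lemma heads_converse: "heads (B\<inverse>) = tails B"
  unfolding heads_def tails_def by (rule sum.reindex_bij_witness[of _ "\<lambda>(x, y). (y, x)" "\<lambda>(x, y). (y, x)"]) auto

lemma lmonom_sum: "(\<Prod>b\<in>B. lmonom (f b)) = lmonom (\<Sum>b\<in>B. f b)"
  by (induction B rule: infinite_finite_induct) (auto simp: lmonom_mult)

text \<open>\<open>S\<close> collects the arcs whose factor supplies its first variable; every other
  arc contributes a minus sign.\<close>

lemma lookup_gpoly:
  assumes "finite E"
  shows "lookup (gpoly E) d =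
    (\<Sum>S\<in>Pow E. if tails S + heads (E - S) = d then (-1) ^ card (E - S) else 0)"
proof -
  have "gpoly E = (\<Prod>b\<in>E. X (fst b) + - X (snd b))"
    by (simp add: gpoly_def case_prod_beta)
  also have "\<dots> = (\<Sum>S\<in>Pow E. (\<Prod>b\<in>S. X (fst b)) * (\<Prod>b\<in>E - S. - X (snd b)))"
    by (rule prod_add[OF assms])
  also have "\<dots> = (\<Sum>S\<in>Pow E. of_int ((-1) ^ card (E - S)) * lmonom (tails S + heads (E - S)))"
    by (rule sum.cong)
      (simp_all add: prod_uminus X_def lmonom_sum tails_def heads_def flip: lmonom_mult)
  finally have "lookup (gpoly E) d = (\<Sum>S\<in>Pow E. (-1) ^ card (E - S) * lookup (lmonom (tails S + heads (E - S))) d)"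
    by (simp only: lookup_sum lookup_of_int_mult)
  also have "\<dots> = (\<Sum>S\<in>Pow E. if tails S + heads (E - S) = d then (-1) ^ card (E - S) else 0)"
    by (rule sum.cong) (auto simp: lmonom_def lookup_single when_def)
  finally show ?thesis .
qed

lemma gpoly_flip:
  assumes E: "finite E" "E \<inter> E\<inverse> = {}" and S: "S \<subseteq> E"
  shows "gpoly ((E - S) \<union> S\<inverse>) = (-1) ^ card S * gpoly E"
proof -
  have finS: "finite S" using S E(1) finite_subset by blast
  have "gpoly (S\<inverse>) = (\<Prod>b\<in>S. - (X (fst b) - X (snd b)))"
    unfolding gpoly_def
    by (rule prod.reindex_bij_witness[of _ "\<lambda>(x, y). (y, x)" "\<lambda>(x, y). (y, x)"]) auto
  then have flip_S: "gpoly (S\<inverse>) = (-1) ^ card S * gpoly S"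
    by (simp only: prod_uminus gpoly_def case_prod_unfold)
  have "gpoly ((E - S) \<union> S\<inverse>) = gpoly (E - S) * gpoly (S\<inverse>)"
    using E S finS by (intro gpoly_Un) auto
  also have "\<dots> = (-1) ^ card S * (gpoly (E - S) * gpoly S)"
    by (simp add: flip_S)
  also have "gpoly (E - S) * gpoly S = gpoly ((E - S) \<union> S)"
    using E finS by (intro gpoly_Un[symmetric]) auto
  finally show ?thesis using S by (simp add: Un_absorb2)
qed

text \<open>A nonzero coefficient has a contributing choice \<open>S\<close>. Reversing the arcs of
  \<open>S\<close> makes each chosen variable the head of its arc, at the cost of a sign.\<close>

lemma obtain_orientation_with_indegrees:
  assumes E: "finite E" "E \<inter> E\<inverse> = {}" and nz: "lookup (gpoly E) d \<noteq> 0"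
  obtains D where "D \<union> D\<inverse> = E \<union> E\<inverse>" "D \<inter> D\<inverse> = {}" "finite D" "heads D = d" "lookup (gpoly D) d \<noteq> 0"
proof -
  obtain S where S: "S \<subseteq> E" "tails S + heads (E - S) = d"
    using nz unfolding lookup_gpoly[OF E(1)] by (auto elim!: sum.not_neutral_contains_not_neutral split: if_splits)
  let ?D = "(E - S) \<union> S\<inverse>"
  have finS: "finite S" using S(1) E(1) finite_subset by blast
  have "heads ?D = heads (E - S) + heads (S\<inverse>)"
    unfolding heads_def using E S finS by (intro sum.union_disjoint) auto
  then have "heads ?D = d"
    using S(2) by (simp add: heads_converse add.commute)
  moreover have "lookup (gpoly ?D) d = (-1) ^ card S * lookup (gpoly E) d"
    using lookup_of_int_mult[of "(-1) ^ card S" "gpoly E" d] by (simp add: gpoly_flip[OF E S(1)])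
  ultimately show ?thesis
    using E S finS nz by (intro that[of ?D]) auto
qed

lemma circulation_iff:
  assumes D: "D \<subseteq> V \<times> V" "finite D"
  shows "circulation E \<lparr>pverts = V, parcs = D\<rparr> \<longleftrightarrow>
    pverts E = V \<and> parcs E \<subseteq> D \<and> heads (parcs E) = tails (parcs E)"
proof -
  have deg: "(\<forall>v\<in>V. in_degree (with_proj E) v = out_degree (with_proj E) v) \<longleftrightarrow>
      heads (parcs E) = tails (parcs E)" if sub: "parcs E \<subseteq> D"
  proof -
    have fin: "finite (parcs E)" using sub D(2) finite_subset by blast
    have "in_degree (with_proj E) v = card {y. (y, v) \<in> parcs E}" for v
      unfolding in_degree_def in_arcs_def
      by (rule bij_betw_same_card[of fst]) (auto simp: bij_betw_def inj_on_def image_iff intro: rev_bexI)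
    then have i: "lookup (heads (parcs E)) v = int (in_degree (with_proj E) v)" for v
      using fin by (simp add: lookup_heads)
    have "out_degree (with_proj E) v = card {y. (y, v) \<in> (parcs E)\<inverse>}" for v
      unfolding out_degree_def out_arcs_def
      by (rule bij_betw_same_card[of snd]) (auto simp: bij_betw_def inj_on_def image_iff intro: rev_bexI)
    then have o: "lookup (tails (parcs E)) v = int (out_degree (with_proj E) v)" for v
      using fin by (simp add: lookup_heads flip: heads_converse)
    \<comment> \<open>Equality of the vectors also concerns vertices outside \<open>V\<close>, where
      both degrees are 0.\<close>
    have z: "in_degree (with_proj E) v = 0 \<and> out_degree (with_proj E) v = 0" if "v \<notin> V" for v
    proof -
      have "in_arcs (with_proj E) v = {}" "out_arcs (with_proj E) v = {}"
        using that sub D(1) by (auto simp: in_arcs_def out_arcs_def)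
      then show ?thesis by (simp add: in_degree_def out_degree_def)
    qed
    show ?thesis
      unfolding poly_mapping_eq_iff fun_eq_iff i o using z by (metis of_nat_eq_iff)
  qed
  have "wf_digraph (with_proj \<lparr>pverts = V, parcs = D\<rparr>)"
    using D(1) by unfold_locales auto
  moreover have "wf_digraph (with_proj E)" if "pverts E = V" "parcs E \<subseteq> D"
    using that D(1) by unfold_locales auto
  ultimately show ?thesis
    using deg unfolding circulation_def spanning_def subgraph_def compatible_def by auto
qed

text \<open>Since \<open>heads D = heads S + heads (D - S)\<close>, a choice \<open>S\<close>
  contributes exactly when \<open>tails S = heads S\<close>, that is, when it is a circulation. Its
  sign is that of \<open>card D\<close> times the parity sign of \<open>card S\<close>.\<close>

lemma lookup_gpoly_heads:
  assumes D: "D \<subseteq> V \<times> V" "finite D"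
  defines "G \<equiv> \<lparr>pverts = V, parcs = D\<rparr>"
  shows "lookup (gpoly D) (heads D) =
    (-1) ^ card D * (int (card (even_circulations G)) - int (card (odd_circulations G)))"
proof -
  define mk where "mk S = \<lparr>pverts = V, parcs = S\<rparr>" for S :: "('a \<times> 'a) set"
  define bal where "bal = {S. S \<subseteq> D \<and> heads S = tails S}"
  have inj: "inj_on mk A" for A by (auto simp: inj_on_def mk_def)
  have fin: "finite bal" using D(2) by (simp add: bal_def)
  have circ: "circulation E G \<longleftrightarrow> pverts E = V \<and> parcs E \<in> bal" for E
    unfolding G_def circulation_iff[OF D] bal_def by simp
  have mk: "mk (parcs E) = E" if "pverts E = V" for E
    using that by (cases E) (simp add: mk_def)
  have img: "{E. (pverts E = V \<and> parcs E \<in> bal) \<and> Q (card (parcs E))} = mk ` {S \<in> bal. Q (card S)}" for Q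
  proof (intro set_eqI iffI)
    fix E :: "'a pair_pre_digraph" assume "E \<in> {E. (pverts E = V \<and> parcs E \<in> bal) \<and> Q (card (parcs E))}"
    then show "E \<in> mk ` {S \<in> bal. Q (card S)}"
      by (intro image_eqI[of _ _ "parcs E"]) (auto simp: mk)
  qed (auto simp: mk_def)
  have "even_circulations G = mk ` {S \<in> bal. even (card S)}"
    unfolding even_circulations_def circ by (rule img)
  moreover have "odd_circulations G = mk ` {S \<in> bal. odd (card S)}"
    unfolding odd_circulations_def circ by (rule img[of odd])
  ultimately have cards: "card (even_circulations G) = card {S \<in> bal. even (card S)}"
    "card (odd_circulations G) = card {S \<in> bal. odd (card S)}"
    by (simp_all add: card_image[OF inj])
  have sum_heads: "heads D = heads S + heads (D - S)" if "S \<subseteq> D" for S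
    using sum.subset_diff[OF that D(2)] by (simp add: heads_def add.commute)
  have "lookup (gpoly D) (heads D) = (\<Sum>S\<in>Pow D. if S \<in> bal then (-1) ^ card (D - S) else 0)"
    unfolding lookup_gpoly[OF D(2)]
    by (rule sum.cong) (use sum_heads in \<open>auto simp: bal_def\<close>)
  also have "\<dots> = (\<Sum>S\<in>Pow D \<inter> {S. S \<in> bal}. (-1) ^ card (D - S))"
    using D(2) by (subst sum.If_cases) (auto simp: Int_def)
  also have "Pow D \<inter> {S. S \<in> bal} = bal"
    by (auto simp: bal_def)
  also have "(\<Sum>S\<in>bal. (-1) ^ card (D - S) :: int) = (\<Sum>S\<in>bal. (-1) ^ card D * (if even (card S) then 1 else - 1))"
  proof (rule sum.cong)
    fix S assume "S \<in> bal"
    then have "card D = card (D - S) + card S"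
      using D(2) by (metis (no_types, lifting) Diff_disjoint Int_commute Un_Diff_cancel2 add.commute bal_def
        card_Un_disjoint finite_Diff finite_subset mem_Collect_eq sup.absorb1)
    then show "(-1) ^ card (D - S) = (-1) ^ card D * (if even (card S) then 1 else - 1 :: int)"
      by (simp add: power_add)
  qed simp
  also have "\<dots> = (-1) ^ card D * (\<Sum>S\<in>bal. if even (card S) then 1 else - 1)"
    by (simp add: sum_distrib_left)
  also have "(\<Sum>S\<in>bal. if even (card S) then 1 else - 1 :: int)
    = int (card {S \<in> bal. even (card S)}) - int (card {S \<in> bal. odd (card S)})"
    using fin by (subst sum.If_cases) (auto simp: Int_def)
  finally show ?thesis by (simp add: cards)
qed

text \<open>An orientation realizing \<open>d\<close> as its indegrees has unequally many even and
  odd circulations, and the strict bound on \<open>d\<close> absorbs the \<open>+ 1\<close> in the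
  definition of the number.\<close>

lemma alon_tarsi_number_le:
  assumes G: "pair_graph G" "pverts G \<noteq> {}" and E: "E \<union> E\<inverse> = parcs G" "E \<inter> E\<inverse> = {}"
    and nz: "lookup (gpoly E) d \<noteq> 0" and d: "\<And>v. lookup d v < int b"
  shows "alon_tarsi_number G \<le> b"
proof -
  interpret pair_graph G by fact
  have "finite E"
    using E(1) pair_finite_arcs by (metis finite_Un)
  then obtain D where D: "D \<union> D\<inverse> = parcs G" "D \<inter> D\<inverse> = {}" "finite D" "heads D = d"
    and nzD: "lookup (gpoly D) d \<noteq> 0"
    using obtain_orientation_with_indegrees[OF _ E(2) nz] E(1) by metis
  let ?D = "\<lparr>pverts = pverts G, parcs = D\<rparr>"
  have sub: "D \<subseteq> pverts G \<times> pverts G"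
    using D(1) wellformed' by auto
  have "card (even_circulations ?D) \<noteq> card (odd_circulations ?D)"
    using nzD lookup_gpoly_heads[OF sub D(3)] D(4) by auto
  moreover have "orientation ?D G"
    using D by (simp add: orientation_def)
  ultimately have "alon_tarsi_number G \<le> max_in_degree ?D + 1"
    unfolding alon_tarsi_number_def by (intro Least_le) blast
  moreover have "in_degree (with_proj ?D) v < b" for v
  proof -
    have "in_degree (with_proj ?D) v = card {y. (y, v) \<in> D}"
      unfolding in_degree_def in_arcs_def
      by (rule bij_betw_same_card[of fst]) (auto simp: bij_betw_def inj_on_def image_iff intro: rev_bexI)
    then show ?thesis
      using d[of v] D(3,4) lookup_heads[of D v] by simp
  qed
  then have "max_in_degree ?D < b"
    unfolding max_in_degree_def using G(2) pair_finite_verts by (subst Max_less_iff) auto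
  ultimately show ?thesis by simp
qed

section \<open>Joins of an odd cycle and a clique\<close>

text \<open>The shape of one extension: old arcs on \<open>S\<close>, new arcs on \<open>T\<close>,
  and a cut from \<open>S\<close> to \<open>T\<close>. It occurs twice per layer, for the clique and
  then for the cycle.\<close>

lemma converse_disjoint_Un_cut:
  assumes "E \<subseteq> S \<times> S" "A \<subseteq> T \<times> T" "B \<subseteq> S \<times> T" "S \<inter> T = {}" "E \<inter> E\<inverse> = {}" "A \<inter> A\<inverse> = {}"
  shows "(E \<union> (A \<union> B)) \<inter> (E \<union> (A \<union> B))\<inverse> = {}"
  using assms by blast

lemma disjoint_cut:
  assumes "E \<subseteq> S \<times> S" "A \<subseteq> T \<times> T" "B \<subseteq> S \<times> T" "S \<inter> T = {}"
  shows "E \<inter> (A \<union> B) = {}"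
  using assms by blast

context cycle_core
begin

lemma cyc_converse_disjoint: "cyc \<inter> cyc\<inverse> = {}"
proof -
  have "vert j \<noteq> vert (Suc i)" if "vert i = vert (Suc j)" for i j
  proof
    assume "vert j = vert (Suc i)"
    then have "vert (Suc j) = vert (i + 2)"
      by (simp add: vert_eq_iff) (metis mod_Suc_eq)
    then show False
      using that vert_neq[of 2 i] n_ge_3 by simp
  qed
  then show ?thesis by (force simp: cyc_def)
qed

end

section \<open>The product as a sequence of layers\<close>

locale cycle_clique_join = cycle_core f n C
  for f :: "nat \<Rightarrow> 'a" and n C +
  fixes Q :: "'a set"
  assumes finite_Q: "finite Q" and Q_disjoint: "Q \<inter> C = {}"
begin

definition join_arcs :: "('a \<times> 'a) set" where
  "join_arcs = cyc \<union> cyc\<inverse> \<union> Q \<times> C \<union> C \<times> Q \<union> {(u, u'). u \<in> Q \<and> u' \<in> Q \<and> u \<noteq> u'}"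

text \<open>With \<open>R\<close> the arcs of \<open>H\<close>, these are the arcs of the product
  induced on the layers in \<open>L\<close>.\<close>

definition layer_arcs :: "('b \<times> 'b) set \<Rightarrow> 'b set \<Rightarrow> (('a \<times> 'b) \<times> ('a \<times> 'b)) set" where
  "layer_arcs R L = {((u, v), (u', v')). u \<in> C \<union> Q \<and> u' \<in> C \<union> Q \<and> v \<in> L \<and> v' \<in> L \<and>
    (u = u' \<and> (v, v') \<in> R \<or> v = v' \<and> (u, u') \<in> join_arcs)}"

text \<open>
  The invariant of the induction over the layers: \<open>J\<close> will be the set of earlier neighbours of
  the next layer, and \<open>m\<close> the largest admissible exponent.
\<close>

definition extendable :: "nat \<Rightarrow> 'b set \<Rightarrow> ('a \<times> 'b) laurent \<Rightarrow> bool" where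
  "extendable m J F \<longleftrightarrow> (\<exists>p\<in>C. \<exists>q\<in>C. \<exists>d. (\<forall>v. lookup d v \<le> int m) \<and>
    lookup (((\<Sum>j\<in>J. X (p, j)) - (\<Sum>j\<in>J. X (q, j))) * F) d \<noteq> 0)"

text \<open>Multiplying by a variable only shifts coefficients, and undoing the shift lowers
  exponents, so the bound survives.\<close>

lemma extendable_singleton_imp:
  assumes "extendable m {w} F"
  shows "\<exists>d. (\<forall>v. lookup d v \<le> int m) \<and> lookup F d \<noteq> 0"
proof -
  obtain p q d where d: "\<forall>v. lookup d v \<le> int m" and "lookup ((X (p, w) - X (q, w)) * F) d \<noteq> 0"
    using assms by (auto simp: extendable_def)
  then have "lookup F (d - expo (p, w)) \<noteq> 0 \<or> lookup F (d - expo (q, w)) \<noteq> 0"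
    by (auto simp: left_diff_distrib lookup_minus lookup_X_mult)
  moreover have "lookup (d - expo x) v \<le> int m" for x v
    using d[rule_format, of v] by (auto simp: lookup_minus lookup_expo)
  ultimately show ?thesis by blast
qed

text \<open>The clique of the new layer goes first and takes exponents below
  \<open>card Q + card J\<close>. The cycle follows; each of its vertices then has
  \<open>card J + card Q\<close> neighbours already present, and \<open>cycle_extension\<close>
  applies.\<close>

lemma add_layer:
  fixes w :: 'b and L :: "'b set"
  assumes R: "sym R" "irrefl R" and L: "finite L" "w \<notin> L"
    and E: "E \<union> E\<inverse> = layer_arcs R L" "E \<inter> E\<inverse> = {}"
  defines "J \<equiv> {v \<in> L. (w, v) \<in> R}"
  assumes bound: "card J \<le> k"
    and nz: "\<exists>d. (\<forall>v. lookup d v \<le> int (card Q + k + 1)) \<and> lookup (gpoly E) d \<noteq> 0"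
    and ext: "card J = k \<longrightarrow> extendable (card Q + k + 1) J (gpoly E)"
  shows "\<exists>E'. E' \<union> E'\<inverse> = layer_arcs R (insert w L) \<and> E' \<inter> E'\<inverse> = {} \<and>
    (\<forall>J'. w \<in> J' \<longrightarrow> J' \<subseteq> insert w L \<longrightarrow> extendable (card Q + k + 1) J' (gpoly E'))"
proof -
  define Cw where "Cw = C \<times> {w}"
  define U where "U = Q \<times> {w}"
  have "bij_betw (\<lambda>u. (u, w)) C Cw"
    by (auto simp: bij_betw_def inj_on_def Cw_def)
  then have "bij_betw (\<lambda>j. (f j, w)) {..<n} Cw"
    using bij_betw_trans[OF bij] by (auto simp: comp_def)
  then interpret K: cycle_core "\<lambda>j. (f j, w)" n Cw
    using n_ge_3 odd_n by unfold_locales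
  have K_vert: "K.vert i = (vert i, w)" for i
    by (simp add: K.vert_def vert_def)
  have K_cyc: "K.cyc = {((u, w), (u', w)) | u u'. (u, u') \<in> cyc}"
    by (auto simp: K.cyc_def cyc_def K_vert)
  have finJ: "finite J" using L(1) by (simp add: J_def)
  have JL: "J \<subseteq> L" "w \<notin> J" using L(2) by (auto simp: J_def)
  have finU: "finite U" using finite_Q by (simp add: U_def)
  have cardU: "card U = card Q" by (simp add: U_def card_cartesian_product)
  have UC: "U \<inter> Cw = {}" using Q_disjoint by (auto simp: U_def Cw_def)
  let ?N = "\<lambda>(u, x :: 'b). {u} \<times> J"
  \<comment> \<open>Cycle vertices also see the clique \<open>U\<close> of their own layer, which is
    already in place.\<close>
  let ?NC = "\<lambda>v. ?N v \<union> U"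
  have N: "finite (?N v)" "card (?N v) = card J" "?N v \<inter> U = {}" "?N v \<inter> Cw = {}" for v
    using finJ JL(2) by (auto simp: case_prod_beta card_cartesian_product U_def Cw_def)
  have "\<forall>v\<in>U. finite (?N v) \<and> ?N v \<inter> U = {} \<and> card (?N v) \<le> card J"
    by (simp only: N) simp
  from lookup_cut_clique[OF finU this] obtain A s c
    where clique: "A \<union> A\<inverse> = {(u, u'). u \<in> U \<and> u' \<in> U \<and> u \<noteq> u'} \<and> A \<inter> A\<inverse> = {} \<and> c \<noteq> 0 \<and>
      (\<forall>v. v \<notin> U \<longrightarrow> lookup s v = 0) \<and> (\<forall>v\<in>U. lookup s v < int (card U + card J)) \<and>
      (\<forall>F d. vfree U F \<longrightarrow> (\<forall>v\<in>U. lookup d v = 0) \<longrightarrow>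
        lookup (F * gpoly (A \<union> {(y, u). u \<in> U \<and> y \<in> ?N u})) (d + s) = c * lookup F d)"
    by (elim exE) (rule that)
  note A = conjunct1[OF clique] conjunct1[OF conjunct2[OF clique]]
  note clique' = conjunct2[OF conjunct2[OF clique]]
  note c = conjunct1[OF clique']
  note s = conjunct1[OF conjunct2[OF clique'], rule_format]
    conjunct1[OF conjunct2[OF conjunct2[OF clique']], rule_format]
  note coeff = conjunct2[OF conjunct2[OF conjunct2[OF clique']], rule_format]
  define BU where "BU = {(y, u). u \<in> U \<and> y \<in> ?N u}"
  define BC where "BC = {(y, u). u \<in> Cw \<and> y \<in> ?NC u}"
  define E1 where "E1 = E \<union> (A \<union> BU)"
  define E2 where "E2 = E1 \<union> (K.cyc \<union> BC)"
  let ?VL = "(C \<union> Q) \<times> L"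
  have E_sub: "E \<subseteq> ?VL \<times> ?VL"
  proof -
    have "E \<subseteq> layer_arcs R L"
      using Un_upper1[of E "E\<inverse>"] unfolding E(1) .
    then show ?thesis by (auto simp: layer_arcs_def)
  qed
  have A_sub: "A \<subseteq> U \<times> U"
    using Un_upper1[of A "A\<inverse>"] unfolding A(1) by auto
  have BU_sub: "BU \<subseteq> ?VL \<times> U"
    using JL(1) by (auto simp: BU_def U_def)
  have BC_sub: "BC \<subseteq> (?VL \<union> U) \<times> Cw"
    using JL(1) by (auto simp: BC_def Cw_def)
  have VL_U: "?VL \<inter> U = {}" and VL_Cw: "?VL \<inter> Cw = {}"
    using L(2) by (auto simp: U_def Cw_def)
  have finVL: "finite ?VL"
    using finite_C finite_Q L(1) by simp
  have finE: "finite E"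
    by (rule finite_subset[OF E_sub finite_cartesian_product[OF finVL finVL]])
  have fin_ABU: "finite (A \<union> BU)"
    by (rule finite_UnI[OF finite_subset[OF A_sub finite_cartesian_product[OF finU finU]]
          finite_subset[OF BU_sub finite_cartesian_product[OF finVL finU]]])
  have E1_sub: "E1 \<subseteq> (?VL \<union> U) \<times> (?VL \<union> U)"
    using E_sub A_sub BU_sub by (auto simp: E1_def)
  have finE1: "finite E1"
    using finE fin_ABU by (simp add: E1_def)
  have fin_KBC: "finite (K.cyc \<union> BC)"
    by (rule finite_UnI[OF K.finite_cyc
          finite_subset[OF BC_sub finite_cartesian_product[OF finite_UnI[OF finVL finU] K.finite_C]]])
  have gpoly_E1: "gpoly E1 = gpoly E * gpoly (A \<union> BU)"
    unfolding E1_def by (rule gpoly_Un[OF finE fin_ABU disjoint_cut[OF E_sub A_sub BU_sub VL_U]])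
  have VLU_Cw: "(?VL \<union> U) \<inter> Cw = {}"
    using VL_Cw UC by (simp add: Int_Un_distrib2)
  have gpoly_E2: "gpoly E2 = gpoly E1 * gpoly (K.cyc \<union> BC)"
    unfolding E2_def
    by (rule gpoly_Un[OF finE1 fin_KBC disjoint_cut[OF E1_sub K.cyc_subset BC_sub VLU_Cw]])

  define join_w where "join_w = {((u, w), (u', w)) | u u'. (u, u') \<in> join_arcs}"
  define cut_w where "cut_w = {((u, j), (u, w)) | u j. u \<in> C \<union> Q \<and> j \<in> J}"
  have BU_BC: "BU \<union> BC = cut_w \<union> U \<times> Cw"
    by (auto simp: BU_def BC_def U_def Cw_def cut_w_def)
  have join_w: "(A \<union> A\<inverse>) \<union> (K.cyc \<union> K.cyc\<inverse>) \<union> U \<times> Cw \<union> Cw \<times> U = join_w"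
    unfolding A(1) K_cyc join_arcs_def U_def Cw_def join_w_def by auto
  have "E2 \<union> E2\<inverse> = (E \<union> E\<inverse>) \<union> ((A \<union> A\<inverse>) \<union> (K.cyc \<union> K.cyc\<inverse>)) \<union> ((BU \<union> BC) \<union> (BU \<union> BC)\<inverse>)"
    unfolding E2_def E1_def converse_Un by (simp only: Un_ac)
  also have "\<dots> = (E \<union> E\<inverse>) \<union> ((A \<union> A\<inverse>) \<union> (K.cyc \<union> K.cyc\<inverse>) \<union> U \<times> Cw \<union> Cw \<times> U) \<union> (cut_w \<union> cut_w\<inverse>)"
    unfolding BU_BC converse_Un converse_Times by (simp only: Un_ac)
  also have "\<dots> = layer_arcs R L \<union> join_w \<union> (cut_w \<union> cut_w\<inverse>)"
    by (simp only: E(1) join_w)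
  also have "\<dots> = layer_arcs R (insert w L)"
  proof -
    have join: "u \<in> C \<union> Q" "u' \<in> C \<union> Q" if "(u, u') \<in> join_arcs" for u u'
      using that cyc_subset by (auto simp: join_arcs_def)
    have loop: "(w, w) \<notin> R" and sym: "(j, w) \<in> R \<longleftrightarrow> (w, j) \<in> R" for j
      using R by (auto simp: irrefl_def dest: symD)
    have mem_layer: "((u, v), (u', v')) \<in> layer_arcs R K \<longleftrightarrow> u \<in> C \<union> Q \<and> u' \<in> C \<union> Q \<and> v \<in> K \<and> v' \<in> K \<and>
        (u = u' \<and> (v, v') \<in> R \<or> v = v' \<and> (u, u') \<in> join_arcs)" for u v u' v' K
      by (simp add: layer_arcs_def)
    have mem_join: "((u, v), (u', v')) \<in> join_w \<longleftrightarrow> v = w \<and> v' = w \<and> (u, u') \<in> join_arcs" for u v u' v'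
      by (auto simp: join_w_def)
    have mem_cut: "((u, v), (u', v')) \<in> cut_w \<longleftrightarrow> u = u' \<and> u \<in> C \<union> Q \<and> v' = w \<and> v \<in> L \<and> (w, v) \<in> R"
      for u v u' v'
      by (auto simp: cut_w_def J_def)
    have "((u, v), (u', v')) \<in> layer_arcs R L \<union> join_w \<union> (cut_w \<union> cut_w\<inverse>) \<longleftrightarrow>
        ((u, v), (u', v')) \<in> layer_arcs R (insert w L)" for u v u' v'
      unfolding Un_iff[of _ _ "cut_w \<union> cut_w\<inverse>"] Un_iff[of _ _ join_w] Un_iff[of _ _ "cut_w\<inverse>"]
        converse_iff mem_layer mem_join mem_cut insert_iff
      using join[of u u'] loop sym[of v] sym[of v'] L(2) by (cases "v = w"; cases "v' = w") auto
    then show ?thesis by auto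
  qed
  finally have E2_sym: "E2 \<union> E2\<inverse> = layer_arcs R (insert w L)" .
  have "E1 \<inter> E1\<inverse> = {}"
    unfolding E1_def by (rule converse_disjoint_Un_cut[OF E_sub A_sub BU_sub VL_U E(2) A(2)])
  then have E2_antisym: "E2 \<inter> E2\<inverse> = {}"
    unfolding E2_def
    by (rule converse_disjoint_Un_cut[OF E1_sub K.cyc_subset BC_sub VLU_Cw _ K.cyc_converse_disjoint])

  have free_E: "vfree (U \<union> Cw) (gpoly E)"
    using VL_U VL_Cw by (intro vfree_gpoly order_trans[OF E_sub] Sigma_mono) blast+
  have free_E1: "vfree Cw (gpoly E1)"
    using VLU_Cw by (intro vfree_gpoly order_trans[OF E1_sub] Sigma_mono) blast+
  have free_J: "vfree (U \<union> Cw) (\<Sum>j\<in>J. X (p, j))" for p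
    using JL(2) by (intro vfree_sum vfree_X) (auto simp: U_def Cw_def)
  \<comment> \<open>Adding the clique shifts the exponent by \<open>s\<close> and scales the
    coefficient by \<open>c\<close>; multipliers free of the new layer pass through
    unchanged.\<close>
  have transfer: "lookup (M * gpoly E1) (d + s) \<noteq> 0 \<and> (\<forall>v\<in>U \<union> Cw. lookup d v = 0)"
    if M: "vfree (U \<union> Cw) M" and d: "lookup (M * gpoly E) d \<noteq> 0" for M d
  proof -
    have free: "vfree (U \<union> Cw) (M * gpoly E)"
      using M free_E by (rule vfree_mult)
    have z: "\<forall>v\<in>U \<union> Cw. lookup d v = 0"
    proof (rule ballI, rule ccontr)
      fix v assume "v \<in> U \<union> Cw" "lookup d v \<noteq> 0"
      then show False using lookup_vfree_eq_0[OF free, of v d] d by simp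
    qed
    have "lookup (M * gpoly E * gpoly (A \<union> BU)) (d + s) = c * lookup (M * gpoly E) d"
      unfolding BU_def using z by (intro coeff vfree_mono[OF free]) auto
    then show ?thesis
      using z c d by (simp add: gpoly_E1 mult.assoc)
  qed
  have NC: "finite (?NC v) \<and> ?NC v \<inter> Cw = {} \<and> card (?NC v) = card J + card Q" for v
  proof -
    have "card (?NC v) = card J + card Q"
      using card_Un_disjoint[OF N(1) finU N(3)] by (simp only: N(2) cardU)
    moreover have "?NC v \<inter> Cw = {}"
      unfolding Int_Un_distrib2 N(4) UC by (rule Un_empty_left)
    ultimately show ?thesis
      by (intro conjI finite_UnI[OF N(1) finU])
  qed

  have "extendable (card Q + k + 1) J' (gpoly E2)" if J': "w \<in> J'" "J' \<subseteq> insert w L" for J'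
  proof -
    \<comment> \<open>The summands of the form for \<open>J'\<close> in layers other than
      \<open>w\<close>.\<close>
    define Z :: "'a \<times> 'b \<Rightarrow> ('a \<times> 'b) laurent" where "Z = (\<lambda>(u, x :: 'b). \<Sum>j\<in>J' - {w}. X (u, j))"
    have finJ': "finite J'" using J' L(1) finite_subset by blast
    have Z: "vfree Cw (Z v)" for v
      unfolding Z_def case_prod_beta by (intro vfree_sum vfree_X) (auto simp: Cw_def)
    have X_Z: "X (u, w) + Z (u, w) = (\<Sum>j\<in>J'. X (u, j))" for u
      using sum.remove[OF finJ' J'(1), of "\<lambda>j. X (u, j)"] by (simp add: Z_def)
    have concl: "extendable (card Q + k + 1) J' (gpoly E2)"
      if pq: "p \<in> Cw" "q \<in> Cw" and e: "\<forall>v. v \<notin> Cw \<longrightarrow> lookup e v = 0"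
        and e_le: "\<forall>v. lookup e v \<le> int m" and m: "m \<le> card Q + k + 1"
        and d: "\<forall>v. lookup d v \<le> int (card Q + k + 1)" "\<forall>v\<in>U \<union> Cw. lookup d v = 0"
        and ne: "lookup ((X p + Z p - (X q + Z q)) * (gpoly E1 * gpoly (K.cyc \<union> BC))) (d + s + e) \<noteq> 0"
      for p q e m d
    proof -
      obtain p' q' where p'q': "p' \<in> C" "q' \<in> C" "p = (p', w)" "q = (q', w)"
        using pq by (auto simp: Cw_def)
      \<comment> \<open>\<open>d\<close>, \<open>s\<close> and \<open>e\<close> live off the new
        layer, on \<open>U\<close> and on \<open>Cw\<close> respectively, so their bounds do not add
        up.\<close>
      have "lookup (d + s + e) v \<le> int (card Q + k + 1)" for v
      proof (cases "v \<in> Cw")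
        case True
        then have "v \<notin> U" using UC by blast
        then have "lookup s v = 0" by (rule s(1))
        moreover have "lookup d v = 0" using True d(2) by blast
        ultimately show ?thesis
          using e_le[rule_format, of v] m by (simp add: lookup_add)
      next
        case False
        then have e0: "lookup e v = 0" using e by blast
        show ?thesis
        proof (cases "v \<in> U")
          case True
          then have "lookup s v < int (card Q + card J)" "lookup d v = 0"
            using s(2)[of v] d(2) cardU by auto
          then show ?thesis
            using e0 bound by (simp add: lookup_add)
        next
          case False
          then have "lookup s v = 0" by (rule s(1))
          then show ?thesis
            using e0 d(1)[rule_format, of v] by (simp add: lookup_add)
        qed
      qed
      moreover have "lookup (((\<Sum>j\<in>J'. X (p', j)) - (\<Sum>j\<in>J'. X (q', j))) * gpoly E2) (d + s + e) \<noteq> 0"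
        using ne unfolding p'q' X_Z gpoly_E2 .
      ultimately show ?thesis
        unfolding extendable_def using p'q'(1,2) by blast
    qed
    have s_Cw: "\<forall>v\<in>Cw. lookup (d + s) v = 0" if "\<forall>v\<in>U \<union> Cw. lookup d v = 0" for d
    proof
      fix v assume "v \<in> Cw"
      then have "v \<notin> U" using UC by blast
      then show "lookup (d + s) v = 0"
        using that s(1) \<open>v \<in> Cw\<close> by (simp only: lookup_add) simp
    qed
    show ?thesis
    \<comment> \<open>If \<open>card J < k\<close>, there is room for exponent
      \<open>card J + card Q + 2\<close> on the cycle. Otherwise \<open>card J + card Q + 1\<close>
      is the limit, and the invariant for \<open>J\<close> provides a nonvanishing linear
      form.\<close>
    proof (cases "card J = k")
      case False
      obtain d where d: "\<forall>v. lookup d v \<le> int (card Q + k + 1)" "lookup (gpoly E) d \<noteq> 0"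
        using nz by blast
      have t: "lookup (gpoly E1) (d + s) \<noteq> 0" "\<forall>v\<in>U \<union> Cw. lookup d v = 0"
        using transfer[of 1 d] d(2) by auto
      from K.cycle_extension_top[of "gpoly E1" ?NC "card J + card Q" Z "d + s",
          OF free_E1 NC Z s_Cw[OF t(2)] t(1)]
      show ?thesis
        unfolding BC_def[symmetric]
      proof (elim bexE exE conjE)
        fix p q e
        assume "p \<in> Cw" "q \<in> Cw" "\<forall>v. v \<notin> Cw \<longrightarrow> lookup e v = 0"
          and e_le: "\<forall>v. lookup e v \<le> int (card J + card Q) + 2"
          and "lookup ((X p + Z p - (X q + Z q)) * (gpoly E1 * gpoly (K.cyc \<union> BC))) (d + s + e) \<noteq> 0"
        moreover have "\<forall>v. lookup e v \<le> int (card J + card Q + 2)"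
          using e_le by (simp add: add.commute)
        moreover have "card J + card Q + 2 \<le> card Q + k + 1"
          using False bound by simp
        ultimately show ?thesis
          using d(1) t(2) by (intro concl[of p q e "card J + card Q + 2" d])
      qed
    next
      case True
      obtain p q d where pq: "p \<in> C" "q \<in> C" and d: "\<forall>v. lookup d v \<le> int (card Q + k + 1)"
        and ne: "lookup (((\<Sum>j\<in>J. X (p, j)) - (\<Sum>j\<in>J. X (q, j))) * gpoly E) d \<noteq> 0"
        using mp[OF ext True] unfolding extendable_def by blast
      have t: "lookup (((\<Sum>j\<in>J. X (p, j)) - (\<Sum>j\<in>J. X (q, j))) * gpoly E1) (d + s) \<noteq> 0"
          "\<forall>v\<in>U \<union> Cw. lookup d v = 0"
        using transfer[OF vfree_diff[OF free_J free_J] ne] by auto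
      \<comment> \<open>The clique variables are common to all cycle vertices, so they cancel in the
        difference and leave the form over \<open>J\<close>.\<close>
      have NC_sum: "(\<Sum>y\<in>?NC (u, w). X y) = (\<Sum>j\<in>J. X (u, j)) + (\<Sum>y\<in>U. X y)" for u
      proof -
        have "(\<Sum>y\<in>?NC (u, w). X y) = (\<Sum>y\<in>{u} \<times> J. X y) + (\<Sum>y\<in>U. X y)"
          using N[of "(u, w)"] finU by (subst sum.union_disjoint) auto
        moreover have "(\<Sum>y\<in>{u} \<times> J. X y) = (\<Sum>j\<in>J. X (u, j))"
          by (rule sum.reindex_bij_witness[of _ "\<lambda>j. (u, j)" snd]) auto
        ultimately show ?thesis by simp
      qed
      have ne': "lookup (((\<Sum>y\<in>?NC (p, w). X y) - (\<Sum>y\<in>?NC (q, w). X y)) * gpoly E1) (d + s) \<noteq> 0"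
        unfolding NC_sum add_diff_cancel_right by (rule t(1))
      have pq': "(p, w) \<in> Cw" "(q, w) \<in> Cw" using pq by (auto simp: Cw_def)
      from K.cycle_extension_subtop[of "gpoly E1" ?NC "card J + card Q" Z "d + s",
          OF free_E1 NC Z s_Cw[OF t(2)] pq' ne']
      show ?thesis
        unfolding BC_def[symmetric]
      proof (elim bexE exE conjE)
        fix p q e
        assume "p \<in> Cw" "q \<in> Cw" "\<forall>v. v \<notin> Cw \<longrightarrow> lookup e v = 0"
          and e_le: "\<forall>v. lookup e v \<le> int (card J + card Q) + 1"
          and "lookup ((X p + Z p - (X q + Z q)) * (gpoly E1 * gpoly (K.cyc \<union> BC))) (d + s + e) \<noteq> 0"
        moreover have "\<forall>v. lookup e v \<le> int (card J + card Q + 1)"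
          using e_le by (simp add: add.commute)
        moreover have "card J + card Q + 1 \<le> card Q + k + 1"
          using True bound by simp
        ultimately show ?thesis
          using d t(2) by (intro concl[of p q e "card J + card Q + 1" d])
      qed
    qed
  qed
  then show ?thesis
    using E2_sym E2_antisym by blast
qed

text \<open>Layers are added in the order of \<open>ws\<close>. By \<open>path\<close> the last
  layer is always among the earlier neighbours of the next one, as the invariant demands.\<close>

lemma gpoly_layers_nonzero:
  assumes R: "sym R" "irrefl R" and k: "1 \<le> k" and ws: "distinct ws"
    and path: "\<And>i. Suc i < length ws \<Longrightarrow> (ws ! Suc i, ws ! i) \<in> R"
    and back_deg: "\<And>i. i < length ws \<Longrightarrow> card {v \<in> set (take i ws). (ws ! i, v) \<in> R} \<le> k"
  shows "\<exists>E d. E \<union> E\<inverse> = layer_arcs R (set ws) \<and> E \<inter> E\<inverse> = {} \<and> lookup (gpoly E) d \<noteq> 0 \<and>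
    (\<forall>v. lookup d v \<le> int (card Q + k + 1))"
proof -
  let ?m = "card Q + k + 1"
  \<comment> \<open>The guard \<open>0 < i\<close> is there because the empty prefix has no last
    layer.\<close>
  have "\<exists>E. E \<union> E\<inverse> = layer_arcs R (set (take i ws)) \<and> E \<inter> E\<inverse> = {} \<and>
      (\<exists>d. (\<forall>v. lookup d v \<le> int ?m) \<and> lookup (gpoly E) d \<noteq> 0) \<and>
      (0 < i \<longrightarrow> (\<forall>J. ws ! (i - 1) \<in> J \<longrightarrow> J \<subseteq> set (take i ws) \<longrightarrow> extendable ?m J (gpoly E)))"
    if "i \<le> length ws" for i
    using that
  proof (induction i)
    case 0
    show ?case
      by (intro exI[of _ "{}"]) (auto simp: layer_arcs_def lookup_one intro!: exI[of _ 0])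
  next
    case (Suc i)
    let ?L = "set (take i ws)" and ?w = "ws ! i"
    let ?J = "{v \<in> ?L. (?w, v) \<in> R}"
    have i: "i < length ws" using Suc.prems by simp
    from Suc.IH[OF Suc_leD[OF Suc.prems]] obtain E
      where IH: "E \<union> E\<inverse> = layer_arcs R ?L \<and> E \<inter> E\<inverse> = {} \<and>
        (\<exists>d. (\<forall>v. lookup d v \<le> int ?m) \<and> lookup (gpoly E) d \<noteq> 0) \<and>
        (0 < i \<longrightarrow> (\<forall>J. ws ! (i - 1) \<in> J \<longrightarrow> J \<subseteq> ?L \<longrightarrow> extendable ?m J (gpoly E)))"
      by (elim exE) (rule that)
    note E = conjunct1[OF IH] conjunct1[OF conjunct2[OF IH]]
    note nz = conjunct1[OF conjunct2[OF conjunct2[OF IH]]]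
    note ext = conjunct2[OF conjunct2[OF conjunct2[OF IH]], rule_format]
    have take_Suc: "set (take (Suc i) ws) = insert ?w ?L"
      using i by (simp add: take_Suc_conv_app_nth)
    have w: "?w \<notin> ?L"
      using ws i by (auto simp: in_set_conv_nth nth_eq_iff_index_eq)
    have ext_J: "card ?J = k \<longrightarrow> extendable ?m ?J (gpoly E)"
    proof
      assume "card ?J = k"
      \<comment> \<open>For the first layer \<open>?J\<close> is empty, and \<open>1 \<le> k\<close>
        rules out \<open>card ?J = k\<close>.\<close>
      then have "i > 0"
        using k by (cases i) auto
      moreover from this have "ws ! (i - 1) \<in> ?L"
        using i by (auto simp: in_set_conv_nth intro!: exI[of _ "i - 1"])
      moreover have "(?w, ws ! (i - 1)) \<in> R"
        using path[of "i - 1"] \<open>i > 0\<close> i by simp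
      ultimately show "extendable ?m ?J (gpoly E)" by (intro ext) auto
    qed
    from add_layer[OF R List.finite_set w E back_deg[OF i] nz ext_J] obtain E'
      where E': "E' \<union> E'\<inverse> = layer_arcs R (insert ?w ?L) \<and> E' \<inter> E'\<inverse> = {} \<and>
        (\<forall>J'. ?w \<in> J' \<longrightarrow> J' \<subseteq> insert ?w ?L \<longrightarrow> extendable ?m J' (gpoly E'))"
      by (elim exE) (rule that)
    note ext' = conjunct2[OF conjunct2[OF E'], rule_format]
    \<comment> \<open>The invariant for the single layer \<open>?w\<close> already yields a nonzero
      coefficient within the bound.\<close>
    have nz': "\<exists>d. (\<forall>v. lookup d v \<le> int ?m) \<and> lookup (gpoly E') d \<noteq> 0"
      by (rule extendable_singleton_imp[of ?m ?w]) (rule ext'; simp)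
    have "0 < Suc i \<longrightarrow> (\<forall>J. ws ! (Suc i - 1) \<in> J \<longrightarrow> J \<subseteq> insert ?w ?L \<longrightarrow> extendable ?m J (gpoly E'))"
      using conjunct2[OF conjunct2[OF E']] by simp
    note result = conjI[OF conjunct1[OF E'] conjI[OF conjunct1[OF conjunct2[OF E']] conjI[OF nz' this]]]
    show ?case
      unfolding take_Suc by (rule exI[of _ E'], rule result)
  qed
  from this[OF order_refl] obtain E d
    where E: "E \<union> E\<inverse> = layer_arcs R (set (take (length ws) ws))" "E \<inter> E\<inverse> = {}"
      and d: "\<forall>v. lookup d v \<le> int ?m" "lookup (gpoly E) d \<noteq> 0"
    by (elim exE conjE) (rule that)
  show ?thesis
    by (intro exI[of _ E] exI[of _ d] conjI E(2) d E(1)[unfolded take_all[OF order_refl]])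
qed

end

section \<open>The bound for Cartesian products\<close>

lemma vwalk_arcs_nth: "Suc i < length p \<Longrightarrow> (p ! i, p ! Suc i) \<in> set (vwalk_arcs p)"
  by (induction p arbitrary: i rule: vwalk_arcs.induct) (auto simp: nth_Cons split: nat.splits)

text \<open>The layers give exponents of at most \<open>card Q + k + 1\<close>. These lie below the
  claimed bound because a cycle vertex has degree at least \<open>card Q + 2\<close> in
  \<open>G\<close>.\<close>

theorem (in cycle_clique_join) alon_tarsi_number_product_le:
  fixes G :: "'a pair_pre_digraph" and H :: "'b pair_pre_digraph"
  assumes G: "pair_graph G" "pverts G = C \<union> Q" "parcs G = join_arcs"
    and H: "pair_graph H" "2 \<le> card (pverts H)" "hamilton_path H ws"
    and back_deg: "\<And>i. i < length ws \<Longrightarrow> card {v \<in> set (take i ws). (ws ! i, v) \<in> parcs H} \<le> k"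
  shows "alon_tarsi_number (G \<box> H) \<le> max_degree G + k"
proof -
  interpret G: pair_graph G by fact
  interpret H: pair_graph H by fact
  have ws: "distinct ws" "set ws = pverts H" "set (vwalk_arcs ws) \<subseteq> parcs H"
    using H(3) by (auto simp: hamilton_path_def vpath_def vwalk_def)
  have R: "sym (parcs H)" "irrefl (parcs H)"
    using H.pair_sym_arcs by (auto simp: symmetric_def irrefl_def dest: H.pair_no_loops)
  have path: "(ws ! Suc i, ws ! i) \<in> parcs H" if "Suc i < length ws" for i
    using vwalk_arcs_nth[OF that] ws(3) R(1) by (auto dest: symD)
  have len: "2 \<le> length ws"
    using H(2) ws distinct_card by metis
  \<comment> \<open>The second vertex of the path has the first one as an earlier neighbour, which
    makes \<open>k\<close> positive.\<close>
  have "ws ! 0 \<in> {v \<in> set (take 1 ws). (ws ! 1, v) \<in> parcs H}"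
    using path[of 0] len by (cases ws) (auto simp: Suc_le_eq)
  then have "0 < card {v \<in> set (take 1 ws). (ws ! 1, v) \<in> parcs H}"
    by (subst card_gt_0_iff) auto
  then have k: "1 \<le> k"
    using back_deg[of 1] len by simp
  obtain E d where E: "E \<union> E\<inverse> = layer_arcs (parcs H) (pverts H)" "E \<inter> E\<inverse> = {}"
    "lookup (gpoly E) d \<noteq> 0" and d: "\<And>v. lookup d v \<le> int (card Q + k + 1)"
    using gpoly_layers_nonzero[OF R k ws(1) path back_deg] ws(2) by auto
  have arcs: "layer_arcs (parcs H) (pverts H) = parcs (G \<box> H)"
    by (auto simp: layer_arcs_def cartesian_product_def G)
  have "card Q + 2 \<le> max_degree G"
  proof -
    \<comment> \<open>Neighbours of \<open>vert 1\<close>: its two neighbours on the cycle and the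
      whole clique.\<close>
    let ?S = "insert (vert 0) (insert (vert 2) Q)"
    have "vert 0 \<noteq> vert 2"
      using vert_neq[of 2 0] n_ge_3 by (auto simp: numeral_2_eq_2)
    moreover have "vert i \<notin> Q" for i
      using Q_disjoint vert_in_C by blast
    ultimately have "card ?S = card Q + 2"
      using finite_Q by simp
    moreover have "Pair (vert 1) ` ?S \<subseteq> out_arcs (with_proj G) (vert 1)"
    proof -
      have "(vert 1, vert 2) \<in> cyc" "(vert 0, vert 1) \<in> cyc"
        using n_ge_3 by (auto simp: cyc_def numeral_2_eq_2 intro!: image_eqI[of _ _ 0] image_eqI[of _ _ 1])
      then show ?thesis
        by (auto simp: G join_arcs_def)
    qed
    then have "card (Pair (vert 1) ` ?S) \<le> out_degree (with_proj G) (vert 1)"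
      unfolding out_degree_def by (intro card_mono) auto
    moreover have "card (Pair (vert 1) ` ?S) = card ?S"
      by (rule card_image) (simp add: inj_on_def)
    ultimately have "card Q + 2 \<le> out_degree (with_proj G) (vert 1)"
      by (simp only:)
    also have "\<dots> \<le> max_degree G"
      unfolding max_degree_def using G.pair_finite_verts vert_in_C G(2) by (intro Max_ge) auto
    finally show ?thesis .
  qed
  then have "lookup d v < int (max_degree G + k)" for v
    using d[of v] by simp
  moreover have "C \<noteq> {}"
    using vert_in_C[of 0] by blast
  then have "pverts (G \<box> H) \<noteq> {}"
    using G(2) len ws(2) by (auto simp: cartesian_product_def)
  ultimately show ?thesis
    using E arcs by (intro alon_tarsi_number_le pair_graph_cartesian_product G(1) H(1)) auto
qed

theorem theorem7:
  fixes G :: "'a pair_pre_digraph" and H :: "'b pair_pre_digraph"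
    and ws :: "'b list" and k :: nat
  assumes "pair_graph G" and "complete_graph G \<or> odd_cycle G" and "card (pverts G) \<ge> 3"
    and "pair_graph H" and "card (pverts H) \<ge> 2"
    and "hamilton_path H ws"
    and "\<And>i. i < length ws \<Longrightarrow> card {v \<in> set (take i ws). (ws ! i, v) \<in> parcs H} \<le> k"
  shows "alon_tarsi_number (G \<box> H) \<le> max_degree G + k"
  using assms(2)
proof
  assume "complete_graph G"
  then have arcs: "parcs G = {(u, v). u \<in> pverts G \<and> v \<in> pverts G \<and> u \<noteq> v}"
    by (auto simp: complete_graph_def complete_digraph_def)
  \<comment> \<open>Any three vertices serve as the odd cycle; the remaining ones form the
    clique.\<close>
  obtain T where T: "T \<subseteq> pverts G" "card T = 3"
    using assms(3) by (meson obtain_subset_with_card_n)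
  then obtain p q r where pqr: "T = {p, q, r}" "p \<noteq> q" "p \<noteq> r" "q \<noteq> r"
    by (auto simp: card_3_iff)
  let ?f = "\<lambda>i. [p, q, r] ! i"
  have less_3: "{..<3} = {0, 1, 2 :: nat}" by auto
  have "bij_betw ?f {..<3} T"
    using pqr by (auto simp: bij_betw_def inj_on_def less_3)
  moreover have "finite (pverts G)"
    using assms(3) by (intro card_ge_0_finite) simp
  ultimately interpret cycle_clique_join ?f 3 T "pverts G - T"
    by unfold_locales auto
  have "cyc = {(p, q), (q, r), (r, p)}"
    unfolding cyc_def vert_def less_3 by simp
  then have "parcs G = join_arcs"
    using T pqr unfolding arcs join_arcs_def by auto
  then show ?thesis
    using assms T(1) by (intro alon_tarsi_number_product_le) auto
next
  assume "odd_cycle G"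
  then obtain n f where n: "odd n" "n \<ge> 3" and f: "bij_betw f {..<n} (pverts G)"
    and arcs: "parcs G = (\<Union>i<n. {(f i, f (Suc i mod n)), (f (Suc i mod n), f i)})"
    by (auto simp: odd_cycle_def cycle_graph_def)
  \<comment> \<open>An odd cycle is the case of an empty clique.\<close>
  interpret cycle_clique_join f n "pverts G" "{}"
    using n f by unfold_locales auto
  have "cyc = (\<lambda>i. (f i, f (Suc i mod n))) ` {..<n}"
    by (auto simp: cyc_def vert_def)
  then have "parcs G = join_arcs"
    unfolding arcs join_arcs_def by auto
  then show ?thesis
    using assms by (intro alon_tarsi_number_product_le) auto
qed

end
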